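(* Let $n\in\mathbb N$, let $\mathbf f\in L_2(\Omega)^d$, and let $\lambda,\mu$ satisfy (A1)--(A4). Suppose in addition that there is a constant $\Lambda>0$ such that $$|\lambda(s)s-\lambda(r)r|\le\Lambda|r-s|\ \ \forall\,r,s\in\mathbb R,\qquad |\mu(s)s-\mu(r)r|\le\Lambda|r-s|\ \ \forall\,r,s\in[0,\infty).$$ Let $(\mathbf T_{n,1},\mathbf u_{n,1})$ be the unique solution of the linearly regularized problem (L$_n$) and $(\mathbf T_{n,1,h},\mathbf u_{n,1,h})$ the unique solution of its finite element approximation (L$_{n,h}$). Then $$\frac1n\|\mathbf T_{n,1,h}-\mathbf T_{n,1}\|_{L_2(\Omega)}\le\inf_{\mathbf v_h\in\mathbb X_{n,h}}\|\varepsilon(\mathbf v_h-\mathbf u_{n,1})\|_{L_2(\Omega)}+2\Big(\frac1n+\Lambda\Big)\|\mathbf T_{n,1}-\Pi_h\mathbf T_{n,1}\|_{L_2(\Omega)}.$$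
   Context: $\Omega\subset\mathbb R^d$, $d\in\{2,3\}$, is a bounded polygonal domain ($d=2$) or bounded Lipschitz polyhedral domain ($d=3$). $\mathbb N=\{1,2,\dots\}$. The subscript "sym" denotes symmetric $d\times d$ tensors; $\mathbf S:\mathbf T=\sum_{i,j}S_{ij}T_{ij}$, $|\mathbf S|^2=\mathbf S:\mathbf S$; $\mathbf S^{\mathbf d}=\mathbf S-\frac1d\mathrm{Tr}(\mathbf S)\mathbf I$; $\varepsilon(\mathbf v)=\frac12(\nabla\mathbf v+(\nabla\mathbf v)^{\rm T})$. Assumptions on the material functions: $\lambda\in\mathcal C^0(\mathbb R)$, $\mu\in\mathcal C^0([0,\infty))$, $s\mapsto\lambda(s)s\in\mathcal C^1(\mathbb R)$, and there are positive constants $C_1,C_2,\kappa,\alpha$ such that (A1) $\frac{C_1s^2}{\kappa+|s|}\le\lambda(s)s^2\le C_2|s|$ for all $s\in\mathbb R$; (A2) $\frac{C_1s^2}{\kappa+s}\le\mu(s)s^2\le C_2s$ for all $s\ge0$; (A3) $0\le\frac{d}{ds}(\lambda(s)s)$ for all $s\in\mathbb R$; (A4) $\frac{C_1}{(\kappa+s)^{\alpha+1}}\le\frac{d}{ds}(\mu(s)s)$ for all $s>0$. Problem (L$_n$): with $\mathbb M_{n,1}=L_2(\Omega)^{d\times d}_{\rm sym}$, $\mathbb X_{n,1}=H^1_0(\Omega)^d$, $a_{n,1}(\mathbf T,\mathbf S)=\frac1n\int_\Omega\mathbf T:\mathbf S\,dx$, $c(\mathbf T;\mathbf R,\mathbf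 S)=\int_\Omega(\lambda(\mathrm{Tr}(\mathbf T))\mathrm{Tr}(\mathbf R)\mathbf I+\mu(|\mathbf T^{\mathbf d}|)\mathbf R^{\mathbf d}):\mathbf S\,dx$, $b(\mathbf S,\mathbf v)=\int_\Omega\mathbf S:\varepsilon(\mathbf v)\,dx$, find $(\mathbf T_{n,1},\mathbf u_{n,1})\in\mathbb M_{n,1}\times\mathbb X_{n,1}$ with $$a_{n,1}(\mathbf T_{n,1},\mathbf S)+c(\mathbf T_{n,1};\mathbf T_{n,1},\mathbf S)-b(\mathbf S,\mathbf u_{n,1})=0\ \ \forall\,\mathbf S\in\mathbb M_{n,1},\qquad b(\mathbf T_{n,1},\mathbf v)=\int_\Omega\mathbf f\cdot\mathbf v\,dx\ \ \forall\,\mathbf v\in\mathbb X_{n,1}.$$ Finite element spaces $\mathbb M_{n,h}\subset L_2(\Omega)^{d\times d}_{\rm sym}$, $\mathbb X_{n,h}\subset H^1_0(\Omega)^d$, either of the following: (i) on a shape-regular family of conforming simplicial subdivisions $(\mathcal T_h)_{h\in(0,1]}$ of $\overline\Omega$, $\mathbb M_{n,h}$ consists of the symmetric tensor fields constant on each $K\in\mathcal T_h$ and $\mathbb X_{n,h}$ of the continuous, elementwise affine $\mathbb R^d$-valued functions vanishing on $\partial\Omega$; (ii) on a shape-regular family of conforming quadrilateral ($d=2$) or hexahedral ($d=3$) subdivisions, $\mathbb M_{n,h}$ consists of the symmetric tensor fields, possibly discontinuous across elements, whose components are on each element mapped polynomials of degree $r\ge1$ in each variable, and $\mathbb X_{n,h}$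 of the continuous $\mathbb R^d$-valued functions vanishing on $\partial\Omega$ whose components are of the same elementwise form. In both cases $\varepsilon(\mathbb X_{n,h})\subset\mathbb M_{n,h}$. $\Pi_h:L_2(\Omega)^{d\times d}_{\rm sym}\to\mathbb M_{n,h}$ is the $L_2$-orthogonal projector (in case (i), the elementwise mean $\Pi_hf|_K=\frac1{|K|}\int_Kf\,dx$ applied componentwise). Discretization (L$_{n,h}$): find $(\mathbf T_{n,1,h},\mathbf u_{n,1,h})\in\mathbb M_{n,h}\times\mathbb X_{n,h}$ with $$a_{n,1}(\mathbf T_{n,1,h},\mathbf S_h)+c(\mathbf T_{n,1,h};\mathbf T_{n,1,h},\mathbf S_h)-b(\mathbf S_h,\mathbf u_{n,1,h})=0\ \ \forall\,\mathbf S_h\in\mathbb M_{n,h},\qquad b(\mathbf T_{n,1,h},\mathbf v_h)=\int_\Omega\mathbf f\cdot\mathbf v_h\,dx\ \ \forall\,\mathbf v_h\in\mathbb X_{n,h}.$$ Both (L$_n$) and (L$_{n,h}$) have exactly one solution. *)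

theory Defs
  imports "HOL-Analysis.Analysis"
begin

text \<open>Conventions.  Points and vectors of d-space are \<open>real^'d\<close>, tensors are \<open>real^'d^'d\<close>; the
  library inner product and norm on \<open>real^'d^'d\<close> are the Frobenius ones, so \<open>S \<bullet> T\<close> is the
  sum of all \<open>S $ i $ j * T $ i $ j\<close>.  Members of function spaces are total functions of which
  only the values on the domain matter, and tensor fields are considered up to null sets.\<close>

section \<open>The domain\<close>

definition polytopal_domain :: "(real^'d) set \<Rightarrow> bool" where
  "polytopal_domain \<Omega> \<longleftrightarrow> open \<Omega> \<and> connected \<Omega> \<and> \<Omega> \<noteq> {} \<and> bounded \<Omega> \<and>
     (\<exists>\<F>. finite \<F> \<and> (\<forall>P\<in>\<F>. polytope P \<and> aff_dim P = int CARD('d) - 1) \<and>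
          frontier \<Omega> = \<Union>\<F>)"

text \<open>Near every boundary point the domain is the strict epigraph, in the direction of a unit
  vector \<open>e\<close>, of a Lipschitz function of the component orthogonal to \<open>e\<close>.\<close>
definition lipschitz_domain :: "(real^'d) set \<Rightarrow> bool" where
  "lipschitz_domain \<Omega> \<longleftrightarrow>
     (\<forall>p\<in>frontier \<Omega>. \<exists>e \<rho> L (\<gamma> :: real^'d \<Rightarrow> real). norm e = 1 \<and> \<rho> > 0 \<and>
        L-lipschitz_on UNIV \<gamma> \<and>
        \<Omega> \<inter> ball p \<rho> = {x \<in> ball p \<rho>. \<gamma> (x - (x \<bullet> e) *\<^sub>R e) < x \<bullet> e})"

definition admissible_domain :: "(real^'d) set \<Rightarrow> bool" where
  "admissible_domain \<Omega> \<longleftrightarrow> polytopal_domain \<Omega> \<and>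
     (CARD('d) = 2 \<or> CARD('d) = 3 \<and> lipschitz_domain \<Omega>)"


section \<open>Lebesgue and Sobolev spaces\<close>

definition L2 :: "(real^'d) set \<Rightarrow> (real^'d \<Rightarrow> 'b::euclidean_space) set" where
  "L2 \<Omega> = {f. f \<in> borel_measurable (lebesgue_on \<Omega>) \<and>
              integrable (lebesgue_on \<Omega>) (\<lambda>x. (norm (f x))\<^sup>2)}"

definition L2_norm :: "(real^'d) set \<Rightarrow> (real^'d \<Rightarrow> 'b::euclidean_space) \<Rightarrow> real" where
  "L2_norm \<Omega> f = sqrt (LINT x|lebesgue_on \<Omega>. (norm (f x))\<^sup>2)"

definition L2_inner ::
    "(real^'d) set \<Rightarrow> (real^'d \<Rightarrow> 'b::euclidean_space) \<Rightarrow> (real^'d \<Rightarrow> 'b) \<Rightarrow> real" where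
  "L2_inner \<Omega> f g = (LINT x|lebesgue_on \<Omega>. f x \<bullet> g x)"

definition L2_sym :: "(real^'d) set \<Rightarrow> (real^'d \<Rightarrow> real^'d^'d) set" where
  "L2_sym \<Omega> = {T \<in> L2 \<Omega>. AE x in lebesgue_on \<Omega>. transpose (T x) = T x}"

definition partial_deriv :: "'d \<Rightarrow> (real^'d \<Rightarrow> real) \<Rightarrow> real^'d \<Rightarrow> real" where
  "partial_deriv j f x = frechet_derivative f (at x) (axis j 1)"

primrec Ck :: "nat \<Rightarrow> (real^'d \<Rightarrow> real) \<Rightarrow> bool" where
  "Ck 0 f \<longleftrightarrow> continuous_on UNIV f"
| "Ck (Suc k) f \<longleftrightarrow> (\<forall>x. f differentiable (at x)) \<and> (\<forall>j. Ck k (partial_deriv j f))"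

text \<open>Smooth functions with compact support in \<open>\<Omega>\<close>.\<close>
definition test_functions :: "(real^'d) set \<Rightarrow> (real^'d \<Rightarrow> real) set" where
  "test_functions \<Omega> = {\<phi>. (\<forall>k. Ck k \<phi>) \<and> (\<exists>K. compact K \<and> K \<subseteq> \<Omega> \<and> (\<forall>x. x \<notin> K \<longrightarrow> \<phi> x = 0))}"

text \<open>\<open>G x $ i $ j\<close> is the weak derivative of component \<open>i\<close> of \<open>v\<close> in direction \<open>j\<close>.\<close>
definition is_weak_gradient ::
    "(real^'d) set \<Rightarrow> (real^'d \<Rightarrow> real^'d) \<Rightarrow> (real^'d \<Rightarrow> real^'d^'d) \<Rightarrow> bool" where
  "is_weak_gradient \<Omega> v G \<longleftrightarrow> G \<in> L2 \<Omega> \<and>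
     (\<forall>\<phi>\<in>test_functions \<Omega>. \<forall>i j.
        (LINT x|lebesgue_on \<Omega>. v x $ i * partial_deriv j \<phi> x) =
        - (LINT x|lebesgue_on \<Omega>. G x $ i $ j * \<phi> x))"

definition H1 :: "(real^'d) set \<Rightarrow> (real^'d \<Rightarrow> real^'d) set" where
  "H1 \<Omega> = {v \<in> L2 \<Omega>. \<exists>G. is_weak_gradient \<Omega> v G}"

text \<open>Meaningful for \<open>v \<in> H1 \<Omega>\<close>, and then unique up to null sets.\<close>
definition weak_gradient :: "(real^'d) set \<Rightarrow> (real^'d \<Rightarrow> real^'d) \<Rightarrow> real^'d \<Rightarrow> real^'d^'d" where
  "weak_gradient \<Omega> v = (SOME G. is_weak_gradient \<Omega> v G)"

definition H1_norm :: "(real^'d) set \<Rightarrow> (real^'d \<Rightarrow> real^'d) \<Rightarrow> real" where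
  "H1_norm \<Omega> v = sqrt ((L2_norm \<Omega> v)\<^sup>2 + (L2_norm \<Omega> (weak_gradient \<Omega> v))\<^sup>2)"

text \<open>The closure of the vector-valued test functions in the \<open>H1\<close> norm.\<close>
definition H10 :: "(real^'d) set \<Rightarrow> (real^'d \<Rightarrow> real^'d) set" where
  "H10 \<Omega> = {v \<in> H1 \<Omega>. \<exists>\<phi> :: nat \<Rightarrow> real^'d \<Rightarrow> real^'d.
     (\<forall>k i. (\<lambda>x. \<phi> k x $ i) \<in> test_functions \<Omega>) \<and>
     (\<lambda>k. H1_norm \<Omega> (\<lambda>x. \<phi> k x - v x)) \<longlonglongrightarrow> 0}"

definition strain :: "(real^'d) set \<Rightarrow> (real^'d \<Rightarrow> real^'d) \<Rightarrow> real^'d \<Rightarrow> real^'d^'d" where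
  "strain \<Omega> v x = (1/2) *\<^sub>R (weak_gradient \<Omega> v x + transpose (weak_gradient \<Omega> v x))"


section \<open>The material functions and the regularized problem\<close>

definition deviator :: "real^'d^'d \<Rightarrow> real^'d^'d" where
  "deviator S = S - (trace S / real CARD('d)) *\<^sub>R mat 1"

text \<open>The last condition includes the differentiability implicit in the lower bound for the
  derivative of \<open>s \<mapsto> \<mu> s * s\<close>.\<close>
definition material_functions ::
    "real \<Rightarrow> real \<Rightarrow> real \<Rightarrow> real \<Rightarrow> (real \<Rightarrow> real) \<Rightarrow> (real \<Rightarrow> real) \<Rightarrow> bool" where
  "material_functions C\<^sub>1 C\<^sub>2 \<kappa> \<alpha> lam \<mu> \<longleftrightarrow>
     C\<^sub>1 > 0 \<and> C\<^sub>2 > 0 \<and> \<kappa> > 0 \<and> \<alpha> > 0 \<and>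
     continuous_on UNIV lam \<and> continuous_on {0..} \<mu> \<and>
     (\<lambda>s. lam s * s) C1_differentiable_on UNIV \<and>
     (\<forall>s. C\<^sub>1 * s\<^sup>2 / (\<kappa> + \<bar>s\<bar>) \<le> lam s * s\<^sup>2 \<and> lam s * s\<^sup>2 \<le> C\<^sub>2 * \<bar>s\<bar>) \<and>
     (\<forall>s\<ge>0. C\<^sub>1 * s\<^sup>2 / (\<kappa> + s) \<le> \<mu> s * s\<^sup>2 \<and> \<mu> s * s\<^sup>2 \<le> C\<^sub>2 * s) \<and>
     (\<forall>s. 0 \<le> deriv (\<lambda>s. lam s * s) s) \<and>
     (\<forall>s>0. (\<lambda>s. \<mu> s * s) differentiable (at s) \<and>
             C\<^sub>1 / (\<kappa> + s) powr (\<alpha> + 1) \<le> deriv (\<lambda>s. \<mu> s * s) s)"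

definition form_a ::
    "nat \<Rightarrow> (real^'d) set \<Rightarrow> (real^'d \<Rightarrow> real^'d^'d) \<Rightarrow> (real^'d \<Rightarrow> real^'d^'d) \<Rightarrow> real" where
  "form_a n \<Omega> T S = 1 / real n * L2_inner \<Omega> T S"

definition form_c ::
    "(real \<Rightarrow> real) \<Rightarrow> (real \<Rightarrow> real) \<Rightarrow> (real^'d) set \<Rightarrow> (real^'d \<Rightarrow> real^'d^'d) \<Rightarrow>
     (real^'d \<Rightarrow> real^'d^'d) \<Rightarrow> (real^'d \<Rightarrow> real^'d^'d) \<Rightarrow> real" where
  "form_c lam \<mu> \<Omega> T R S =
     (LINT x|lebesgue_on \<Omega>.
        ((lam (trace (T x)) * trace (R x)) *\<^sub>R mat 1 +
         \<mu> (norm (deviator (T x))) *\<^sub>R deviator (R x)) \<bullet> S x)"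

definition form_b :: "(real^'d) set \<Rightarrow> (real^'d \<Rightarrow> real^'d^'d) \<Rightarrow> (real^'d \<Rightarrow> real^'d) \<Rightarrow> real" where
  "form_b \<Omega> S v = L2_inner \<Omega> S (strain \<Omega> v)"

text \<open>The mixed problem posed in a pair of spaces \<open>M\<close>, \<open>X\<close>.  The continuous problem has
  \<open>M = L2_sym \<Omega>\<close> and \<open>X = H10 \<Omega>\<close>, its discretization has finite element spaces.\<close>
definition regularized_solution ::
    "nat \<Rightarrow> (real \<Rightarrow> real) \<Rightarrow> (real \<Rightarrow> real) \<Rightarrow> (real^'d) set \<Rightarrow> (real^'d \<Rightarrow> real^'d) \<Rightarrow>
     (real^'d \<Rightarrow> real^'d^'d) set \<Rightarrow> (real^'d \<Rightarrow> real^'d) set \<Rightarrow>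
     (real^'d \<Rightarrow> real^'d^'d) \<Rightarrow> (real^'d \<Rightarrow> real^'d) \<Rightarrow> bool" where
  "regularized_solution n lam \<mu> \<Omega> f M X T u \<longleftrightarrow> T \<in> M \<and> u \<in> X \<and>
     (\<forall>S\<in>M. form_a n \<Omega> T S + form_c lam \<mu> \<Omega> T T S - form_b \<Omega> S u = 0) \<and>
     (\<forall>v\<in>X. form_b \<Omega> T v = L2_inner \<Omega> f v)"


section \<open>Simplicial elements\<close>

definition simplicial_mesh :: "(real^'d) set \<Rightarrow> (real^'d) set set \<Rightarrow> bool" where
  "simplicial_mesh \<Omega> \<T> \<longleftrightarrow> triangulation \<T> \<and> (\<forall>K\<in>\<T>. int CARD('d) simplex K) \<and>
     \<Union>\<T> = closure \<Omega>"

definition inradius :: "(real^'d) set \<Rightarrow> real" where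
  "inradius K = Sup {\<rho>. 0 \<le> \<rho> \<and> (\<exists>x. cball x \<rho> \<subseteq> K)}"

definition simplicial_family :: "(real^'d) set \<Rightarrow> (real \<Rightarrow> (real^'d) set set) \<Rightarrow> bool" where
  "simplicial_family \<Omega> \<T> \<longleftrightarrow> (\<forall>h\<in>{0<..1}. simplicial_mesh \<Omega> (\<T> h)) \<and>
     (\<exists>\<sigma>. \<forall>h\<in>{0<..1}. \<forall>K\<in>\<T> h. diameter K \<le> \<sigma> * inradius K)"

definition P0_tensors :: "(real^'d) set \<Rightarrow> (real^'d) set set \<Rightarrow> (real^'d \<Rightarrow> real^'d^'d) set" where
  "P0_tensors \<Omega> \<T> = {T \<in> L2_sym \<Omega>. \<forall>K\<in>\<T>. \<exists>C. AE x in lebesgue_on K. T x = C}"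

text \<open>Membership in \<open>H10 \<Omega>\<close> follows from the other conditions; it is listed because the space is
  introduced as a subspace of \<open>H10 \<Omega>\<close>.\<close>
definition P1_vectors :: "(real^'d) set \<Rightarrow> (real^'d) set set \<Rightarrow> (real^'d \<Rightarrow> real^'d) set" where
  "P1_vectors \<Omega> \<T> = {v \<in> H10 \<Omega>. continuous_on (closure \<Omega>) v \<and> (\<forall>x\<in>frontier \<Omega>. v x = 0) \<and>
     (\<forall>K\<in>\<T>. \<exists>A b. \<forall>x\<in>K. v x = A *v x + b)}"


section \<open>Quadrilateral and hexahedral elements\<close>

text \<open>Polynomials of degree at most \<open>r\<close> in each variable.\<close>
definition Q_polys :: "nat \<Rightarrow> (real^'d \<Rightarrow> real) set" where
  "Q_polys r = {p. \<exists>c. \<forall>x. p x = (\<Sum>\<beta>\<in>{\<beta> :: 'd \<Rightarrow> nat. \<forall>i. \<beta> i \<le> r}. c \<beta> * (\<Prod>i\<in>UNIV. x $ i ^ \<beta> i))}"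

definition ref_cube :: "(real^'d) set" where
  "ref_cube = cbox 0 (\<chi> i. 1)"

text \<open>A mesh is encoded by its element maps \<open>F\<close>, which are bilinear or trilinear; the elements
  are the sets \<open>F ` ref_cube\<close>.  Two distinct elements meet in the image of a proper, possibly
  empty, face of the cube under either of the two maps.\<close>
definition cubical_mesh :: "(real^'d) set \<Rightarrow> (real^'d \<Rightarrow> real^'d) set \<Rightarrow> bool" where
  "cubical_mesh \<Omega> \<Q> \<longleftrightarrow> finite \<Q> \<and>
     (\<forall>F\<in>\<Q>. (\<forall>i. (\<lambda>x. F x $ i) \<in> Q_polys 1) \<and> inj_on F ref_cube) \<and>
     (\<Union>F\<in>\<Q>. F ` ref_cube) = closure \<Omega> \<and>
     (\<forall>F\<in>\<Q>. \<forall>G\<in>\<Q>. F \<noteq> G \<longrightarrow>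
        (\<exists>A B. A face_of ref_cube \<and> A \<noteq> ref_cube \<and> B face_of ref_cube \<and> B \<noteq> ref_cube \<and>
               F ` ref_cube \<inter> G ` ref_cube = F ` A \<and> F ` A = G ` B))"

text \<open>Shape regularity of mapped elements: the derivative of the element map and its inverse are
  bounded by multiples of the diameter and of the reciprocal of the diameter, uniformly in the
  family.  In particular the Jacobians do not vanish.\<close>
definition cubical_family :: "(real^'d) set \<Rightarrow> (real \<Rightarrow> (real^'d \<Rightarrow> real^'d) set) \<Rightarrow> bool" where
  "cubical_family \<Omega> \<Q> \<longleftrightarrow> (\<forall>h\<in>{0<..1}. cubical_mesh \<Omega> (\<Q> h)) \<and>
     (\<exists>\<sigma>. \<forall>h\<in>{0<..1}. \<forall>F\<in>\<Q> h. \<forall>x\<in>ref_cube. \<forall>w.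
        norm (frechet_derivative F (at x) w) \<le> \<sigma> * diameter (F ` ref_cube) * norm w \<and>
        diameter (F ` ref_cube) * norm w \<le> \<sigma> * norm (frechet_derivative F (at x) w))"

definition Q_tensors ::
    "(real^'d) set \<Rightarrow> nat \<Rightarrow> (real^'d \<Rightarrow> real^'d) set \<Rightarrow> (real^'d \<Rightarrow> real^'d^'d) set" where
  "Q_tensors \<Omega> r \<Q> = {T \<in> L2_sym \<Omega>. \<forall>F\<in>\<Q>. \<forall>i j. \<exists>p\<in>Q_polys r.
     AE x in lebesgue_on (F ` ref_cube). T x $ i $ j = p (inv_into ref_cube F x)}"

text \<open>For affine element maps the strain of a member of this space belongs to \<open>Q_tensors\<close> with
  the same \<open>r\<close>.  For general bilinear or trilinear maps this can fail, since derivatives of mapped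
  polynomials need not be mapped polynomials.\<close>
definition Q_vectors ::
    "(real^'d) set \<Rightarrow> nat \<Rightarrow> (real^'d \<Rightarrow> real^'d) set \<Rightarrow> (real^'d \<Rightarrow> real^'d) set" where
  "Q_vectors \<Omega> r \<Q> = {v \<in> H10 \<Omega>. continuous_on (closure \<Omega>) v \<and> (\<forall>x\<in>frontier \<Omega>. v x = 0) \<and>
     (\<forall>F\<in>\<Q>. \<forall>i. \<exists>p\<in>Q_polys r. \<forall>x\<in>F ` ref_cube. v x $ i = p (inv_into ref_cube F x))}"


section \<open>Projection\<close>

definition L2_projector ::
    "(real^'d) set \<Rightarrow> (real^'d \<Rightarrow> real^'d^'d) set \<Rightarrow>
     ((real^'d \<Rightarrow> real^'d^'d) \<Rightarrow> real^'d \<Rightarrow> real^'d^'d) \<Rightarrow> bool" where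
  "L2_projector \<Omega> M proj \<longleftrightarrow>
     (\<forall>T\<in>L2_sym \<Omega>. proj T \<in> M \<and> (\<forall>S\<in>M. L2_inner \<Omega> (\<lambda>x. T x - proj T x) S = 0))"

end

theory Submission
  imports Defs
begin

text \<open>Write \<open>\<sigma>\<close> for the constitutive map, \<open>P\<close> for the projection of \<open>T\<close>, and let \<open>x\<close> and \<open>t\<close> be the norms
  of \<open>R = T\<^sub>h - P\<close> and \<open>T - P\<close>.  Testing both problems with \<open>R\<close>, which is orthogonal to \<open>T - P\<close> and to all
  discrete strains, gives \<open>x\<^sup>2 / n = (\<sigma> T - \<sigma> T\<^sub>h, R) + (R, strain (v - u))\<close> for every discrete \<open>v\<close>.
  Lipschitz continuity of \<open>\<sigma>\<close> alone would introduce the constant \<open>d * \<Lambda>\<close>, as the trace part is only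
  \<open>d * \<Lambda>\<close>-Lipschitz, and this is too large for \<open>d = 3\<close>.  Being monotone as well, \<open>\<sigma>\<close> is cocoercive
  with constant \<open>L = d * \<Lambda>\<close>, so for \<open>g = \<sigma> T - \<sigma> T\<^sub>h\<close> one has
  \<open>(g, R) = (g, T - P) - (g, T - T\<^sub>h) \<le> norm g * t - (norm g)\<^sup>2 / L \<le> L * t\<^sup>2 / 4\<close>, and the estimate
  follows from a quadratic inequality for \<open>x\<close>.  That strains are linear up to null sets, and that
  strains of piecewise affine functions are piecewise constant, rests on the uniqueness of weak
  gradients.\<close>

section \<open>Smooth bump functions\<close>

text \<open>\<open>flat 1\<close> is the classical exp(-1/t) extended by zero. The polynomial in 1/t
  makes the family closed under differentiation, so smoothness follows by induction.\<close>

definition flat :: "real poly \<Rightarrow> real \<Rightarrow> real" where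
  "flat p t = (if t \<le> 0 then 0 else poly p (inverse t) * exp (- inverse t))"

lemma poly_exp_tendsto_0:
  fixes p :: "real poly"
  shows "((\<lambda>x. poly p x * exp (- x)) \<longlongrightarrow> 0) at_top"
proof -
  have "((\<lambda>x. \<Sum>i\<le>degree p. coeff p i * (x ^ i / exp x)) \<longlongrightarrow> (\<Sum>i\<le>degree p. coeff p i * 0)) at_top"
    by (intro tendsto_intros tendsto_power_div_exp_0)
  moreover have "(\<lambda>x. \<Sum>i\<le>degree p. coeff p i * (x ^ i / exp x)) = (\<lambda>x. poly p x * exp (- x))"
    by (simp add: fun_eq_iff poly_altdef sum_distrib_right exp_minus divide_inverse mult.assoc)
  ultimately show ?thesis by simp
qed

lemma flat_at_right_0: "(flat p \<longlongrightarrow> 0) (at_right 0)"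
proof -
  have "((\<lambda>t. poly p (inverse t) * exp (- inverse t)) \<longlongrightarrow> 0) (at_right 0)"
    by (rule filterlim_compose[OF poly_exp_tendsto_0 filterlim_inverse_at_top_right])
  then show ?thesis
    by (rule Lim_transform_eventually)
      (auto simp: flat_def eventually_at_right_field intro!: exI[of _ 1])
qed

lemma flat_at_0: "(flat p \<longlongrightarrow> 0) (at 0)"
proof -
  have "(flat p \<longlongrightarrow> 0) (at_left 0)"
    by (rule Lim_transform_eventually[OF tendsto_const])
      (auto simp: flat_def eventually_at_left_field intro!: exI[of _ "-1"])
  then show ?thesis
    using flat_at_right_0 filterlim_split_at by blast
qed

text \<open>By the chain rule with \<open>(inverse t)\<^sup>2 = - d/dt (inverse t)\<close>.\<close>
definition flat_diff :: "real poly \<Rightarrow> real poly" where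
  "flat_diff p = [:0, 0, 1:] * (p - pderiv p)"

lemma flat_has_derivative: "(flat p has_real_derivative flat (flat_diff p) t) (at t)"
proof -
  consider "t > 0" | "t < 0" | "t = 0" by linarith
  then show ?thesis
  proof cases
    case 1
    have "((\<lambda>t. poly p (inverse t) * exp (- inverse t)) has_real_derivative
            flat (flat_diff p) t) (at t)"
      using 1
      by (auto intro!: derivative_eq_intros DERIV_chain2[OF poly_DERIV]
          simp: flat_def flat_diff_def field_simps power2_eq_square)
    then show ?thesis
      by (rule DERIV_cong_ev[THEN iffD1, rotated -1])
        (use 1 in \<open>auto simp: flat_def eventually_nhds intro!: exI[of _ "{0<..}"]\<close>)
  next
    case 2
    have "((\<lambda>t. 0) has_real_derivative flat (flat_diff p) t) (at t)"
      using 2 by (simp add: flat_def)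
    then show ?thesis
      by (rule DERIV_cong_ev[THEN iffD1, rotated -1])
        (use 2 in \<open>auto simp: flat_def eventually_nhds intro!: exI[of _ "{..<0}"]\<close>)
  next
    case 3
    \<comment> \<open>Dividing by \<open>h\<close> multiplies the polynomial in 1/h by its variable,
      so away from 0 the difference quotient is another member of the family, which tends to
      0.\<close>
    have "((\<lambda>h. flat p h / h) \<longlongrightarrow> 0) (at 0)"
      by (rule Lim_transform_eventually[OF flat_at_0[of "[:0, 1:] * p"]])
        (auto simp: flat_def divide_inverse eventually_at_filter)
    then show ?thesis
      by (simp add: 3 DERIV_def flat_def)
  qed
qed

section \<open>Calculus of partial derivatives and of the classes \<open>Ck\<close>\<close>

lemma partial_deriv_eq:
  assumes "(f has_derivative f') (at x)"
  shows "partial_deriv j f x = f' (axis j 1)"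
  by (metis assms frechet_derivative_at partial_deriv_def)

text \<open>\<open>Ck\<close> demands continuity only at the bottom of its recursion; in the base
  case differentiability supplies it.\<close>

lemma Ck_Suc_D: "Ck (Suc k) f \<Longrightarrow> Ck k f"
proof (induction k arbitrary: f)
  case 0
  then show ?case
    by (auto intro!: continuous_at_imp_continuous_on differentiable_imp_continuous_within)
next
  case (Suc k)
  then show ?case
    unfolding Ck.simps(2)[of "Suc k"] Ck.simps(2)[of k] by blast
qed

lemma Ck_continuous: "Ck k f \<Longrightarrow> continuous_on UNIV f"
  by (induction k) (auto simp del: Ck.simps(2) dest: Ck_Suc_D)

lemma partial_deriv_const: "partial_deriv j (\<lambda>x. c) = (\<lambda>x. 0)"
  by (rule ext, subst partial_deriv_eq[OF has_derivative_const]) auto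

lemma Ck_const: "Ck k (\<lambda>x. c)"
  by (induction k arbitrary: c) (auto simp: partial_deriv_const)

lemma partial_deriv_add:
  assumes "f differentiable (at x)" "g differentiable (at x)"
  shows "partial_deriv j (\<lambda>x. f x + g x) x = partial_deriv j f x + partial_deriv j g x"
  unfolding partial_deriv_def
  by (subst frechet_derivative_at[symmetric,
        OF has_derivative_add[OF assms[unfolded frechet_derivative_works]]]) simp

lemma partial_deriv_mult:
  assumes "f differentiable (at x)" "g differentiable (at x)"
  shows "partial_deriv j (\<lambda>x. f x * g x) x =
    f x * partial_deriv j g x + partial_deriv j f x * g x"
  unfolding partial_deriv_def
  by (subst frechet_derivative_at[symmetric,
        OF has_derivative_mult[OF assms[unfolded frechet_derivative_works]]]) simp

lemma Ck_add: "Ck k f \<Longrightarrow> Ck k g \<Longrightarrow> Ck k (\<lambda>x. f x + g x)"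
proof (induction k arbitrary: f g)
  case (Suc k)
  then have "partial_deriv j (\<lambda>x. f x + g x) = (\<lambda>x. partial_deriv j f x + partial_deriv j g x)" for j
    by (auto simp: partial_deriv_add)
  with Suc show ?case by auto
qed (auto intro: continuous_intros)

lemma Ck_mult: "Ck k f \<Longrightarrow> Ck k g \<Longrightarrow> Ck k (\<lambda>x. f x * g x)"
proof (induction k arbitrary: f g)
  case (Suc k)
  have "partial_deriv j (\<lambda>x. f x * g x) =
      (\<lambda>x. f x * partial_deriv j g x + partial_deriv j f x * g x)" for j
    using Suc.prems by (auto simp: partial_deriv_mult)
  \<comment> \<open>The product rule leaves one factor undifferentiated; \<open>Ck_Suc_D\<close>
    brings it down to class \<open>Ck k\<close>.\<close>
  then show ?case
    using Suc.prems Suc.prems[THEN Ck_Suc_D] Suc.IH by (auto intro!: Ck_add)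
qed (auto intro: continuous_intros)

lemma Ck_prod: "finite I \<Longrightarrow> (\<And>i. i \<in> I \<Longrightarrow> Ck k (f i)) \<Longrightarrow> Ck k (\<lambda>x. \<Prod>i\<in>I. f i x)"
  by (induction I rule: finite_induct) (auto intro: Ck_const Ck_mult)

text \<open>Each differentiation replaces \<open>p\<close> by \<open>flat_diff p\<close> up to a
  constant factor, so the induction runs over all polynomials at once.\<close>

lemma Ck_flat: "Ck k (\<lambda>x. flat p (c * x $ i + d))"
proof (induction k arbitrary: p)
  case 0
  have "continuous_on UNIV (flat p)"
    using flat_has_derivative by (meson DERIV_isCont continuous_at_imp_continuous_on)
  then have "continuous_on UNIV (flat p \<circ> (\<lambda>x. c * x $ i + d))"
    by (intro continuous_on_compose continuous_intros) (auto intro: continuous_on_subset)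
  then show ?case by (simp add: o_def)
next
  case (Suc k)
  have der: "((\<lambda>x. flat p (c * x $ i + d)) has_derivative
      (\<lambda>h. (c * h $ i) * flat (flat_diff p) (c * x $ i + d))) (at x)" for x
  proof -
    have "(flat p has_derivative (\<lambda>h. h * flat (flat_diff p) (c * x $ i + d))) (at (c * x $ i + d))"
      using flat_has_derivative[of p "c * x $ i + d"]
      by (simp add: has_field_derivative_def mult_commute_abs)
    moreover have "((\<lambda>x. c * x $ i + d) has_derivative (\<lambda>h. c * h $ i)) (at x)"
      by (auto intro!: derivative_eq_intros bounded_linear_imp_has_derivative bounded_linear_vec_nth)
    ultimately show ?thesis
      using diff_chain_at[of "\<lambda>x. c * x $ i + d" _ x "flat p"] by (auto simp: o_def)
  qed
  have "partial_deriv j (\<lambda>x. flat p (c * x $ i + d)) =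
      (\<lambda>x. (c * axis j 1 $ i) * flat (flat_diff p) (c * x $ i + d))" for j
    by (rule ext) (simp add: partial_deriv_eq[OF der])
  then show ?case
    using Suc by (auto simp: differentiable_def intro!: Ck_mult Ck_const der)
qed

lemma Ck_affine:
  fixes A :: "real^'n^'n"
  shows "Ck k (\<lambda>x. (A *v x + b) $ i)"
    and partial_deriv_affine: "partial_deriv j (\<lambda>x. (A *v x + b) $ i) x = A $ i $ j"
proof -
  have der: "((\<lambda>x. (A *v x + b) $ i) has_derivative (\<lambda>h. (A *v h) $ i)) (at x)" for x
    by (auto intro!: derivative_eq_intros bounded_linear.has_derivative[OF bounded_linear_vec_nth]
        bounded_linear_imp_has_derivative matrix_vector_mul_bounded_linear)
  have pd: "partial_deriv j (\<lambda>x. (A *v x + b) $ i) x = A $ i $ j" for j x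
    unfolding partial_deriv_eq[OF der] by (simp add: matrix_vector_mult_basis column_def)
  then show "partial_deriv j (\<lambda>x. (A *v x + b) $ i) x = A $ i $ j" .
  show "Ck k (\<lambda>x. (A *v x + b) $ i)"
  proof (cases k)
    case 0
    then show ?thesis
      using der by (auto intro!: continuous_at_imp_continuous_on has_derivative_continuous)
  next
    case (Suc m)
    have "partial_deriv j (\<lambda>x. (A *v x + b) $ i) = (\<lambda>x. A $ i $ j)" for j
      by (rule ext) (rule pd)
    then show ?thesis
      using der Suc by (auto simp: differentiable_def Ck_const)
  qed
qed

lemma flat_1_le_1: "0 \<le> flat 1 t" "flat 1 t \<le> 1"
  by (auto simp: flat_def)

lemma flat_1_tendsto:
  assumes "t > 0"
  shows "(\<lambda>m. flat 1 (real m * t)) \<longlonglongrightarrow> 1"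
proof -
  have "(\<lambda>m. inverse (real m * t)) \<longlonglongrightarrow> 0"
    using tendsto_mult_left[OF lim_inverse_n, of "inverse t"] by (simp add: ac_simps)
  from tendsto_exp[OF tendsto_minus[OF this]]
  have "(\<lambda>m. exp (- inverse (real m * t))) \<longlonglongrightarrow> 1" by simp
  then show ?thesis
    by (rule Lim_transform_eventually)
      (use assms in \<open>auto simp: flat_def eventually_sequentially mult_le_0_iff intro!: exI[of _ 1]\<close>)
qed

text \<open>A smooth substitute for the indicator of \<open>box a b\<close>: every coordinate has a
  cutoff at either end, sharpened as \<open>m\<close> grows. The arguments are written as affine
  functions of \<open>x $ i\<close> to match \<open>Ck_flat\<close>.\<close>

definition box_bump :: "real^'n \<Rightarrow> real^'n \<Rightarrow> nat \<Rightarrow> real^'n \<Rightarrow> real" where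
  "box_bump a b m x =
     (\<Prod>i\<in>UNIV. flat 1 (real m * x $ i + - real m * a $ i) * flat 1 (- real m * x $ i + real m * b $ i))"

lemma box_bump_bounds: "0 \<le> box_bump a b m x" "box_bump a b m x \<le> 1"
  unfolding box_bump_def
  by (auto intro!: prod_nonneg prod_le_1 mult_nonneg_nonneg mult_le_one flat_1_le_1)

lemma box_bump_outside: "x \<notin> box a b \<Longrightarrow> box_bump a b m x = 0"
proof -
  assume "x \<notin> box a b"
  then obtain i where "x $ i \<le> a $ i \<or> b $ i \<le> x $ i"
    by (auto simp: mem_box_cart not_less)
  then have "real m * x $ i + - real m * a $ i \<le> 0 \<or> - real m * x $ i + real m * b $ i \<le> 0"
    using mult_left_mono[of "x $ i" "a $ i" "real m"] mult_left_mono[of "b $ i" "x $ i" "real m"]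
    by force
  then have "flat 1 (real m * x $ i + - real m * a $ i) * flat 1 (- real m * x $ i + real m * b $ i) = 0"
    by (metis flat_def mult_eq_0_iff)
  then show ?thesis
    unfolding box_bump_def by (intro prod_zero) auto
qed

lemma box_bump_tendsto: "(\<lambda>m. box_bump a b m x) \<longlonglongrightarrow> indicator (box a b) x"
proof (cases "x \<in> box a b")
  case True
  have "(\<lambda>m. \<Prod>i\<in>UNIV. flat 1 (real m * (x $ i - a $ i)) * flat 1 (real m * (b $ i - x $ i)))
      \<longlonglongrightarrow> (\<Prod>i\<in>(UNIV::'a set). 1 * 1)"
    using True by (intro tendsto_prod tendsto_mult flat_1_tendsto) (auto simp: mem_box_cart)
  then show ?thesis
    using True by (simp add: box_bump_def algebra_simps)
qed (simp add: box_bump_outside)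

lemma box_bump_test:
  assumes "cbox a b \<subseteq> U"
  shows "box_bump a b m \<in> test_functions U"
proof -
  have "Ck k (box_bump a b m)" for k
    unfolding box_bump_def[abs_def] by (intro Ck_prod Ck_mult Ck_flat) auto
  moreover have "box_bump a b m x = 0" if "x \<notin> cbox a b" for x
    using that box_subset_cbox[of a b] by (intro box_bump_outside) auto
  ultimately show ?thesis
    unfolding test_functions_def using assms by (auto intro!: exI[of _ "cbox a b"])
qed

section \<open>The fundamental lemma of the calculus of variations\<close>

lemma test_functionsD:
  assumes "\<phi> \<in> test_functions U"
  shows "Ck k \<phi>" "continuous_on UNIV \<phi>" "\<phi> differentiable (at x)" "x \<notin> U \<Longrightarrow> \<phi> x = 0"
    "Ck k (partial_deriv j \<phi>)" "continuous_on UNIV (partial_deriv j \<phi>)"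
proof -
  show C: "Ck k \<phi>" for k
    using assms by (auto simp: test_functions_def)
  show "continuous_on UNIV \<phi>" by (rule Ck_continuous[OF C])
  show "\<phi> differentiable (at x)" "Ck k (partial_deriv j \<phi>)" for x k j using C[of "Suc k"] by auto
  then show "continuous_on UNIV (partial_deriv j \<phi>)" using Ck_continuous by blast
  show "x \<notin> U \<Longrightarrow> \<phi> x = 0"
    using assms by (auto simp: test_functions_def)
qed

lemma test_functions_mono: "U \<subseteq> V \<Longrightarrow> test_functions U \<subseteq> test_functions V"
  unfolding test_functions_def by blast

lemma partial_deriv_support:
  assumes "compact K" "\<And>x. x \<notin> K \<Longrightarrow> \<phi> x = 0" "x \<notin> K"
  shows "partial_deriv j \<phi> x = 0"
proof -
  have "open (- K)" using assms(1) by (simp add: compact_imp_closed open_Compl)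
  then have "(\<phi> has_derivative (\<lambda>h. 0)) (at x)"
    by (rule has_derivative_transform_within_open[OF has_derivative_const[of 0]])
      (use assms in auto)
  then show ?thesis by (simp add: partial_deriv_eq)
qed

lemma test_partial_deriv_outside:
  assumes "\<phi> \<in> test_functions U" "x \<notin> U"
  shows "partial_deriv j \<phi> x = 0"
proof -
  from assms(1) obtain K where "compact K" "K \<subseteq> U" "\<And>x. x \<notin> K \<Longrightarrow> \<phi> x = 0"
    by (auto simp: test_functions_def)
  with assms(2) show ?thesis by (intro partial_deriv_support[of K]) auto
qed

text \<open>A pi-lambda argument: boxes are stable under intersection and generate the Borel sets.
  Null sets lead on to the Lebesgue sets, and vanishing integrals over all of these force
  \<open>g\<close> to vanish almost everywhere.\<close>

lemma integral_eq_0_of_boxes: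
  fixes g :: "'a::euclidean_space \<Rightarrow> real"
  assumes g: "integrable lebesgue g"
    and box: "\<And>a b. (LINT x|lebesgue. indicator (box a b) x * g x) = 0"
  shows "AE x in lebesgue. g x = 0"
proof -
  have int: "integrable lebesgue (\<lambda>x. indicator A x * g x)" if "A \<in> sets lebesgue" for A
    using integrable_mult_indicator[OF that g] by simp
  have sigma: "sigma_sets UNIV (range (\<lambda>(a, b). box a b)) = sets (borel :: 'a measure)"
    by (subst borel_eq_box) simp
  have borel: "(LINT x|lebesgue. indicator A x * g x) = 0" if "A \<in> sets borel" for A
  proof -
    have "Int_stable (range (\<lambda>(a, b). box a b :: 'a set))"
      "range (\<lambda>(a, b). box a b :: 'a set) \<subseteq> Pow UNIV"
      "A \<in> sigma_sets UNIV (range (\<lambda>(a, b). box a b))"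
      using that by (auto simp: sigma Int_stable_def box_Int_box)
    then show ?thesis
    proof (induction rule: sigma_sets_induct_disjoint)
      case (compl A)
      then have A: "A \<in> sets lebesgue"
        unfolding sigma by (simp add: sets_completionI_sets)
      \<comment> \<open>A complement requires the integral of \<open>g\<close> over the whole space,
        which is the limit of the integrals over growing cubes.\<close>
      have "(\<lambda>m. LINT x|lebesgue. indicator (box (- (real m *\<^sub>R One)) (real m *\<^sub>R One)) x * g x)
        \<longlonglongrightarrow> (LINT x|lebesgue. g x)"
      proof (rule integral_dominated_convergence[where w = "\<lambda>x. norm (g x)"])
        show "AE x in lebesgue. (\<lambda>m. indicator (box (- (real m *\<^sub>R One)) (real m *\<^sub>R One)) x * g x)
            \<longlonglongrightarrow> g x"
        proof (rule AE_I2)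
          fix x :: 'a
          have "eventually (\<lambda>m. g x = indicator (box (- (real m *\<^sub>R One)) (real m *\<^sub>R One)) x * g x) sequentially"
          proof -
            obtain N where N: "norm x < real N" using reals_Archimedean2 by blast
            have "x \<in> box (- (real m *\<^sub>R One)) (real m *\<^sub>R One)" if "m \<ge> N" for m
            proof -
              have "\<bar>x \<bullet> i\<bar> < real m" if "i \<in> Basis" for i
                using Basis_le_norm[OF that, of x] N \<open>m \<ge> N\<close> by linarith
              then show ?thesis by (fastforce simp: mem_box abs_less_iff)
            qed
            then show ?thesis
              by (auto simp: eventually_sequentially intro!: exI[of _ N])
          qed
          then show "(\<lambda>m. indicator (box (- (real m *\<^sub>R One)) (real m *\<^sub>R One)) x * g x) \<longlonglongrightarrow> g x"
            by (rule Lim_transform_eventually[OF tendsto_const])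
        qed
        show "(\<lambda>x. indicator (box (- (real m *\<^sub>R One)) (real m *\<^sub>R One)) x * g x) \<in> borel_measurable lebesgue" for m
          by (intro borel_measurable_integrable int) simp
      qed (use g in \<open>auto simp: indicator_def\<close>)
      then have "(LINT x|lebesgue. g x) = 0"
        unfolding box by (simp add: LIMSEQ_const_iff)
      moreover have "(LINT x|lebesgue. indicator (UNIV - A) x * g x) =
          (LINT x|lebesgue. g x - indicator A x * g x)"
        by (intro Bochner_Integration.integral_cong) (auto simp: indicator_def)
      ultimately show ?case
        using compl.IH int[OF A] g by simp
    next
      case (union A)
      then have A: "A i \<in> sets lebesgue" for i
        unfolding sigma by (simp add: sets_completionI_sets)
      have "(LINT x:(\<Union>i. A i)|lebesgue. g x) = (\<Sum>i. (LINT x:(A i)|lebesgue. g x))"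
        using union.hyps A g
        by (intro lebesgue_integral_countable_add)
          (auto simp: disjoint_family_on_def set_integrable_def intro!: int)
      also have "\<dots> = 0"
        using union.IH by (simp add: set_lebesgue_integral_def)
      finally show ?case by (simp add: set_lebesgue_integral_def)
    qed (use box in auto)
  qed
  \<comment> \<open>A Lebesgue set is a Borel set together with part of a null set, which the
    integral does not see.\<close>
  have "(LINT x|lebesgue. indicator A x * g x) = 0" if "A \<in> sets lebesgue" for A
  proof -
    from that obtain S N N' where A: "A = S \<union> N" "N \<subseteq> N'" "N' \<in> null_sets lborel" "S \<in> sets lborel"
      by (rule sets_completionE)
    have "AE x in lebesgue. x \<notin> N'"
      using A(3) by (intro AE_completion AE_not_in)
    then have "(LINT x|lebesgue. indicator A x * g x) = (LINT x|lebesgue. indicator S x * g x)"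
      using int[OF that] int[of S] A
      by (intro integral_cong_AE) (auto simp: indicator_def elim: eventually_mono)
    then show ?thesis using borel A(4) by simp
  qed
  then show ?thesis
    by (intro density_unique_real[of _ g "\<lambda>x. 0", simplified])
      (use g in \<open>auto simp: set_lebesgue_integral_def\<close>)
qed

text \<open>The bumps lie between 0 and 1 and converge pointwise to the indicator, so dominated
  convergence with bound \<open>norm (g x)\<close> applies.\<close>

lemma integral_box_of_test_functions:
  fixes g :: "real^'n \<Rightarrow> real"
  assumes U: "open U" and g: "integrable (lebesgue_on U) g"
    and test: "\<And>\<phi>. \<phi> \<in> test_functions U \<Longrightarrow> (LINT x|lebesgue_on U. g x * \<phi> x) = 0"
    and sub: "cbox a b \<subseteq> U"
  shows "(LINT x|lebesgue_on U. g x * indicator (box a b) x) = 0"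
proof -
  have "(\<lambda>m. LINT x|lebesgue_on U. g x * box_bump a b m x)
      \<longlonglongrightarrow> (LINT x|lebesgue_on U. g x * indicator (box a b) x)"
  proof (rule integral_dominated_convergence[where w = "\<lambda>x. norm (g x)"])
    show "(\<lambda>x. g x * indicator (box a b) x) \<in> borel_measurable (lebesgue_on U)"
      using g by (intro borel_measurable_times borel_measurable_integrable[OF g]
          measurable_restrict_space1[OF borel_measurable_indicator]) auto
    show "(\<lambda>x. g x * box_bump a b m x) \<in> borel_measurable (lebesgue_on U)" for m
      using g U test_functionsD(2)[OF box_bump_test[OF sub]]
      by (intro borel_measurable_times borel_measurable_integrable[OF g]
          continuous_imp_measurable_on_sets_lebesgue)
        (auto intro: continuous_on_subset)
    show "AE x in lebesgue_on U. (\<lambda>m. g x * box_bump a b m x) \<longlonglongrightarrow> g x * indicator (box a b) x"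
      by (auto intro!: tendsto_intros box_bump_tendsto)
    show "AE x in lebesgue_on U. norm (g x * box_bump a b m x) \<le> norm (g x)" for m
      using box_bump_bounds[of a b m] by (auto simp: abs_mult intro!: mult_left_le)
  qed (use g in auto)
  then show ?thesis
    by (simp add: test[OF box_bump_test[OF sub]] LIMSEQ_const_iff)
qed

text \<open>Integrals of \<open>g\<close> are known to vanish only over boxes with
  \<open>cbox a b\<close> inside \<open>U\<close>. The box criterion is therefore applied to
  \<open>g\<close> cut off to one such box, and countably many closed boxes exhaust
  \<open>U\<close>.\<close>

lemma fundamental_lemma:
  fixes g :: "real^'n \<Rightarrow> real"
  assumes U: "open U" and g: "integrable (lebesgue_on U) g"
    and test: "\<And>\<phi>. \<phi> \<in> test_functions U \<Longrightarrow> (LINT x|lebesgue_on U. g x * \<phi> x) = 0"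
  shows "AE x in lebesgue_on U. g x = 0"
proof -
  have Um: "U \<in> sets lebesgue" using U by auto
  have gU: "integrable lebesgue (\<lambda>x. indicator U x * g x)"
    using g Um by (simp add: integrable_restrict_space)
  have local: "AE x in lebesgue. x \<in> box c d \<longrightarrow> g x = 0" if sub: "cbox c d \<subseteq> U" for c d
  proof -
    have dU: "box c d \<subseteq> U" using sub box_subset_cbox by blast
    \<comment> \<open>After the cutoff an arbitrary box acts through its intersection with
      \<open>box c d\<close>, which is again a box and has its closure in \<open>U\<close>.\<close>
    have "AE x in lebesgue. indicator (box c d) x * (indicator U x * g x) = 0"
    proof (rule integral_eq_0_of_boxes)
      show "integrable lebesgue (\<lambda>x. indicator (box c d) x * (indicator U x * g x))"
        using integrable_mult_indicator[OF _ gU, of "box c d"] by simp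
      fix a b :: "real^'n"
      obtain a' b' where ab: "box a b \<inter> box c d = box a' b'"
        using box_Int_box by blast
      have "(LINT x|lebesgue. indicator (box a b) x * (indicator (box c d) x * (indicator U x * g x)))
          = (LINT x|lebesgue. indicator U x *\<^sub>R (g x * indicator (box a' b') x))"
        unfolding ab[symmetric] by (intro Bochner_Integration.integral_cong) (auto simp: indicator_def)
      also have "\<dots> = (LINT x|lebesgue_on U. g x * indicator (box a' b') x)"
        using Um by (simp add: integral_restrict_space)
      also have "\<dots> = 0"
      \<comment> \<open>For an empty \<open>box a' b'\<close> nothing places
        \<open>cbox a' b'\<close> inside \<open>U\<close>, but then the integrand is zero.\<close>
      proof (cases "box a' b' = {}")
        case False
        then have "cbox a' b' = closure (box a' b')" by (simp add: closure_box)
        also have "\<dots> \<subseteq> cbox c d"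
          unfolding ab[symmetric] by (intro closure_minimal) (use box_subset_cbox in auto)
        finally show ?thesis
          using sub by (intro integral_box_of_test_functions[OF U g test]) auto
      qed simp
      finally show "(LINT x|lebesgue. indicator (box a b) x *
          (indicator (box c d) x * (indicator U x * g x))) = 0" .
    qed
    then show ?thesis
      by eventually_elim (use dU in \<open>auto simp: indicator_def split: if_splits\<close>)
  qed
  obtain \<D> where D: "countable \<D>" "\<D> \<subseteq> Pow U" "\<And>X. X \<in> \<D> \<Longrightarrow> \<exists>a b. X = cbox a b" "\<Union>\<D> = U"
    using open_countable_Union_open_cbox[OF U] by metis
  have "AE x in lebesgue. x \<in> X \<longrightarrow> g x = 0" if XD: "X \<in> \<D>" for X
  proof -
    obtain a b where X: "X = cbox a b" using D(3)[OF XD] by blast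
    \<comment> \<open>\<open>local\<close> covers open boxes only; the boundaries of the closed
      boxes of the cover are null.\<close>
    have "AE x in lebesgue. x \<notin> frontier (cbox a b)"
      using negligible_convex_frontier[of "cbox a b"]
      by (intro AE_not_in) (simp add: negligible_iff_null_sets)
    moreover have "AE x in lebesgue. x \<in> box a b \<longrightarrow> g x = 0"
      using D(2) XD X by (intro local) auto
    ultimately show ?thesis
      by eventually_elim (auto simp: X frontier_def)
  qed
  then have "AE x in lebesgue. \<forall>X\<in>\<D>. x \<in> X \<longrightarrow> g x = 0"
    by (subst AE_ball_countable) (use D(1) in auto)
  then have "AE x in lebesgue. x \<in> U \<longrightarrow> g x = 0"
    by eventually_elim (use D(4) in blast)
  then show ?thesis
    using Um by (simp add: AE_restrict_space_iff)
qed

section \<open>Integration by parts\<close>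

lemma integrable_compact_support:
  fixes f :: "'a::euclidean_space \<Rightarrow> real"
  assumes "compact K" "\<And>x. x \<notin> K \<Longrightarrow> f x = 0" "continuous_on UNIV f"
  shows "integrable lborel f"
proof -
  have "integrable lborel (\<lambda>x. indicator K x *\<^sub>R f x)"
    using borel_integrable_compact[OF assms(1) continuous_on_subset[OF assms(3)]]
    by (simp add: indicator_def if_distrib[of "\<lambda>c. c *\<^sub>R _"] cong: if_cong)
  moreover have "(\<lambda>x. indicator K x *\<^sub>R f x) = f"
    using assms(2) by (auto simp: indicator_def fun_eq_iff)
  ultimately show ?thesis by simp
qed

text \<open>By translation invariance the difference quotients of \<phi> have integral zero. They
  converge to the partial derivative, and the mean value theorem with compact support supplies the
  dominating function.\<close>

lemma integral_partial_deriv_eq_0: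
  assumes "\<phi> \<in> test_functions UNIV"
  shows "(LINT x|lborel. partial_deriv j \<phi> x) = 0"
proof -
  obtain K where K: "compact K" "\<And>x. x \<notin> K \<Longrightarrow> \<phi> x = 0"
    using assms by (auto simp: test_functions_def)
  note T = test_functionsD[OF assms]
  define e :: "real^'a" where "e = axis j 1"
  have e: "norm e = 1" by (simp add: e_def)
  obtain r where r: "\<And>x. x \<in> K \<Longrightarrow> norm x \<le> r"
    using compact_imp_bounded[OF K(1)] by (auto simp: bounded_iff)
  have bdd: "\<exists>B. \<forall>x. \<bar>partial_deriv j \<phi> x\<bar> \<le> B"
  proof -
    have "compact (partial_deriv j \<phi> ` K)"
      using K(1) T(6) by (intro compact_continuous_image) (auto intro: continuous_on_subset)
    then have "bounded (partial_deriv j \<phi> ` K)" by (rule compact_imp_bounded)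
    then obtain B where "\<And>x. x \<in> K \<Longrightarrow> \<bar>partial_deriv j \<phi> x\<bar> \<le> B"
      by (auto simp: bounded_iff)
    then have "\<bar>partial_deriv j \<phi> x\<bar> \<le> max B 0" for x
      using partial_deriv_support[of K \<phi> x j] K by (cases "x \<in> K") (auto intro: max.coboundedI1)
    then show ?thesis by blast
  qed
  then obtain B where B: "\<And>x. \<bar>partial_deriv j \<phi> x\<bar> \<le> B" by blast
  have line: "((\<lambda>s. \<phi> (x + s *\<^sub>R e)) has_real_derivative partial_deriv j \<phi> (x + s *\<^sub>R e)) (at s)" for x s
  proof -
    have 1: "(\<phi> has_derivative frechet_derivative \<phi> (at (x + s *\<^sub>R e))) (at (x + s *\<^sub>R e))"
      using T(3) by (simp add: frechet_derivative_works)
    have 2: "((\<lambda>s. x + s *\<^sub>R e) has_derivative (\<lambda>t. t *\<^sub>R e)) (at s)"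
      by (auto intro!: derivative_eq_intros)
    have "((\<lambda>s. \<phi> (x + s *\<^sub>R e)) has_derivative
        (\<lambda>t. frechet_derivative \<phi> (at (x + s *\<^sub>R e)) (t *\<^sub>R e))) (at s)"
      using diff_chain_at[OF 2 1] by (simp add: o_def)
    moreover have "frechet_derivative \<phi> (at (x + s *\<^sub>R e)) (t *\<^sub>R e) = partial_deriv j \<phi> (x + s *\<^sub>R e) * t" for t
      using linear_scale[OF has_derivative_linear[OF 1]] by (simp add: partial_deriv_def e_def)
    ultimately show ?thesis by (simp add: has_field_derivative_def)
  qed
  \<comment> \<open>The difference quotient with step 1/(m + 1); \<open>Suc\<close> keeps the step
    well defined and at most 1.\<close>
  define q where "q m x = real (Suc m) * (\<phi> (x + (1 / real (Suc m)) *\<^sub>R e) - \<phi> x)" for m x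
  have int: "integrable lborel \<phi>"
    using K T(2) by (intro integrable_compact_support)
  have meas: "\<phi> \<in> borel_measurable borel" "partial_deriv j \<phi> \<in> borel_measurable borel"
    using T by (auto intro: borel_measurable_continuous_onI)
  have shift: "integrable lborel (\<lambda>x. \<phi> (x + c))" "(LINT x|lborel. \<phi> (x + c)) = (LINT x|lborel. \<phi> x)" for c
  proof -
    have D: "lborel = distr lborel borel ((+) c)" by (simp add: lborel_distr_plus)
    show "integrable lborel (\<lambda>x. \<phi> (x + c))"
      using int by (subst (asm) D, subst (asm) integrable_distr_eq) (use meas in \<open>auto simp: add.commute\<close>)
    show "(LINT x|lborel. \<phi> (x + c)) = (LINT x|lborel. \<phi> x)"
      by (subst (2) D, subst integral_distr) (use meas in \<open>auto simp: add.commute\<close>)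
  qed
  have "(LINT x|lborel. q m x) = 0" for m
    unfolding q_def using int shift by simp
  moreover have "(\<lambda>m. LINT x|lborel. q m x) \<longlonglongrightarrow> (LINT x|lborel. partial_deriv j \<phi> x)"
  \<comment> \<open>The radius exceeds the bound \<open>r\<close> for \<open>K\<close> by the
    largest step 1, so for \<open>x\<close> outside the ball both points of the quotient miss
    \<open>K\<close>.\<close>
  proof (rule integral_dominated_convergence[where w = "\<lambda>x. B * indicator (cball 0 (r + 1)) x"])
    show "integrable lborel (\<lambda>x::real^'a. B * indicator (cball 0 (r + 1)) x)"
      using emeasure_lborel_cball_finite[of "0::real^'a" "r + 1"]
      by (intro integrable_mult_right integrable_real_indicator) auto
    show "AE x in lborel. (\<lambda>m. q m x) \<longlonglongrightarrow> partial_deriv j \<phi> x"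
    proof (rule AE_I2)
      fix x
      have "((\<lambda>h. (\<phi> (x + h *\<^sub>R e) - \<phi> x) / h) \<longlongrightarrow> partial_deriv j \<phi> x) (at 0)"
        using line[of x 0] by (simp add: DERIV_def)
      moreover have "filterlim (\<lambda>m. 1 / real (Suc m)) (at 0) sequentially"
        using LIMSEQ_inverse_real_of_nat by (auto simp: filterlim_at divide_inverse)
      ultimately have "(\<lambda>m. (\<phi> (x + (1 / real (Suc m)) *\<^sub>R e) - \<phi> x) / (1 / real (Suc m))) \<longlonglongrightarrow> partial_deriv j \<phi> x"
        by (rule filterlim_compose)
      then show "(\<lambda>m. q m x) \<longlonglongrightarrow> partial_deriv j \<phi> x"
        by (simp add: q_def mult.commute)
    qed
    have "\<bar>q m x\<bar> \<le> B * indicator (cball 0 (r + 1)) x" for m x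
    proof (cases "x \<in> cball 0 (r + 1)")
      case True
      have "\<exists>z>0. z < 1 / real (Suc m) \<and> \<phi> (x + (1 / real (Suc m)) *\<^sub>R e) - \<phi> (x + 0 *\<^sub>R e) =
          (1 / real (Suc m) - 0) * partial_deriv j \<phi> (x + z *\<^sub>R e)"
        using line by (intro MVT2) auto
      then obtain z where "\<phi> (x + (1 / real (Suc m)) *\<^sub>R e) - \<phi> x =
          (1 / real (Suc m)) * partial_deriv j \<phi> (x + z *\<^sub>R e)" by auto
      then have "q m x = partial_deriv j \<phi> (x + z *\<^sub>R e)"
        unfolding q_def by simp
      with True B show ?thesis by simp
    next
      case False
      then have x: "norm x > r + 1" by simp
      have "norm x \<le> norm (x + (1 / real (Suc m)) *\<^sub>R e) + norm ((1 / real (Suc m)) *\<^sub>R e)"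
        by (metis add_diff_cancel_right' norm_triangle_ineq4)
      moreover have "norm ((1 / real (Suc m)) *\<^sub>R e) \<le> 1" by (simp add: e)
      ultimately have "norm (x + (1 / real (Suc m)) *\<^sub>R e) > r" using x by linarith
      then have "x \<notin> K" "x + (1 / real (Suc m)) *\<^sub>R e \<notin> K"
        using r x by fastforce+
      then show ?thesis using False by (simp add: q_def K(2))
    qed
    then show "AE x in lborel. norm (q m x) \<le> B * indicator (cball 0 (r + 1)) x" for m by simp
    show "q m \<in> borel_measurable lborel" for m
      unfolding q_def[abs_def] using meas shift(1)[of "(1 / real (Suc m)) *\<^sub>R e"] by auto
  qed (use meas in auto)
  ultimately show ?thesis
    by (simp add: LIMSEQ_const_iff)
qed

text \<open>The product of the affine function with \<phi> is a test function on the whole space, so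
  its partial derivative integrates to zero; the product rule does the rest.\<close>

lemma affine_integration_by_parts:
  fixes A :: "real^'n^'n"
  assumes "\<phi> \<in> test_functions U"
  shows "(LINT x|lebesgue. (A *v x + b) $ i * partial_deriv j \<phi> x) =
    (LINT x|lebesgue. - (A $ i $ j * \<phi> x))"
proof -
  define l where "l x = (A *v x + b) $ i" for x
  have lC: "Ck k l" for k unfolding l_def[abs_def] by (rule Ck_affine)
  have lpd: "partial_deriv j l x = A $ i $ j" for x
    unfolding l_def[abs_def] by (rule partial_deriv_affine)
  obtain K where K: "compact K" "\<And>x. x \<notin> K \<Longrightarrow> \<phi> x = 0"
    using assms by (auto simp: test_functions_def)
  note T = test_functionsD[OF assms]
  have int: "integrable lborel f" if "continuous_on UNIV f" "\<And>x. x \<notin> K \<Longrightarrow> f x = 0" for f :: "real^'n \<Rightarrow> real"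
    using K that by (intro integrable_compact_support)
  have cont: "continuous_on UNIV l" by (rule Ck_continuous[OF lC])
  have i1: "integrable lborel (\<lambda>x. l x * partial_deriv j \<phi> x)"
    using cont T(6) K by (intro int continuous_intros) (auto simp: partial_deriv_support[of K \<phi>])
  have i3: "integrable lborel \<phi>"
    using T(2) K by (intro int) auto
  have i2: "integrable lborel (\<lambda>x. A $ i $ j * \<phi> x)"
    using T(2) K by (intro int continuous_intros) auto
  have "(\<lambda>x. l x * \<phi> x) \<in> test_functions UNIV"
    unfolding test_functions_def using lC T(1) K by (auto intro!: Ck_mult)
  from integral_partial_deriv_eq_0[OF this, of j]
  have "(LINT x|lborel. l x * partial_deriv j \<phi> x + A $ i $ j * \<phi> x) = 0"
    using T(3) lC[of 1] by (simp add: partial_deriv_mult lpd)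
  then have "(LINT x|lborel. l x * partial_deriv j \<phi> x) = (LINT x|lborel. - (A $ i $ j * \<phi> x))"
    using i1 i2 by simp
  moreover have "(LINT x|lebesgue. f x) = (LINT x|lborel. f x)"
    if "integrable lborel f" for f :: "real^'n \<Rightarrow> real"
    using that by (intro integral_completion) auto
  ultimately show ?thesis
    unfolding l_def[symmetric] using i1 i2 i3 by simp
qed

section \<open>Square integrable functions\<close>

lemma L2_diff:
  assumes "f \<in> L2 \<Omega>" "g \<in> L2 \<Omega>"
  shows "(\<lambda>x. f x - g x) \<in> L2 \<Omega>"
proof -
  have m: "(\<lambda>x. f x - g x) \<in> borel_measurable (lebesgue_on \<Omega>)"
    using assms by (auto simp: L2_def intro: borel_measurable_diff)
  have "integrable (lebesgue_on \<Omega>) (\<lambda>x. (norm (f x - g x))\<^sup>2)"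
  proof (rule Bochner_Integration.integrable_bound)
    show "integrable (lebesgue_on \<Omega>) (\<lambda>x. 2 * (norm (f x))\<^sup>2 + 2 * (norm (g x))\<^sup>2)"
      using assms by (auto simp: L2_def)
    have "(norm (f x - g x))\<^sup>2 \<le> 2 * (norm (f x))\<^sup>2 + 2 * (norm (g x))\<^sup>2" for x
    proof -
      have "(norm (f x - g x))\<^sup>2 \<le> (norm (f x) + norm (g x))\<^sup>2"
        by (intro power_mono norm_triangle_ineq4) auto
      then show ?thesis
        using sum_squares_bound[of "norm (f x)" "norm (g x)"] by (simp add: power2_sum)
    qed
    then show "AE x in lebesgue_on \<Omega>. norm ((norm (f x - g x))\<^sup>2) \<le>
        norm (2 * (norm (f x))\<^sup>2 + 2 * (norm (g x))\<^sup>2)"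
      by (simp add: order_trans[OF _ abs_ge_self])
  qed (use m in measurable)
  with m show ?thesis by (simp add: L2_def)
qed

lemma L2_of_bound:
  assumes "f \<in> L2 \<Omega>" "g \<in> borel_measurable (lebesgue_on \<Omega>)"
    and "\<And>x. norm (g x) \<le> c * norm (f x)"
  shows "g \<in> L2 \<Omega>"
proof -
  have "integrable (lebesgue_on \<Omega>) (\<lambda>x. (norm (g x))\<^sup>2)"
  proof (rule Bochner_Integration.integrable_bound)
    show "integrable (lebesgue_on \<Omega>) (\<lambda>x. c\<^sup>2 * (norm (f x))\<^sup>2)"
      using assms(1) by (auto simp: L2_def)
    have "(norm (g x))\<^sup>2 \<le> c\<^sup>2 * (norm (f x))\<^sup>2" for x
      using power_mono[OF assms(3)[of x] norm_ge_zero, of 2] by (simp add: power_mult_distrib)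
    then show "AE x in lebesgue_on \<Omega>. norm ((norm (g x))\<^sup>2) \<le> norm (c\<^sup>2 * (norm (f x))\<^sup>2)"
      by simp
  qed (use assms(2) in measurable)
  with assms(2) show ?thesis by (simp add: L2_def)
qed

lemma L2_inner_integrable:
  assumes "f \<in> L2 \<Omega>" "g \<in> L2 \<Omega>"
  shows "integrable (lebesgue_on \<Omega>) (\<lambda>x. f x \<bullet> g x)"
proof (rule Bochner_Integration.integrable_bound)
  show "integrable (lebesgue_on \<Omega>) (\<lambda>x. (norm (f x))\<^sup>2 + (norm (g x))\<^sup>2)"
    using assms by (auto simp: L2_def)
  show "(\<lambda>x. f x \<bullet> g x) \<in> borel_measurable (lebesgue_on \<Omega>)"
    using assms by (auto simp: L2_def intro: borel_measurable_inner)
  have "\<bar>f x \<bullet> g x\<bar> \<le> (norm (f x))\<^sup>2 + (norm (g x))\<^sup>2" for x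
  proof -
    have "\<bar>f x \<bullet> g x\<bar> \<le> norm (f x) * norm (g x)" by (rule Cauchy_Schwarz_ineq2)
    moreover have "2 * norm (f x) * norm (g x) \<le> (norm (f x))\<^sup>2 + (norm (g x))\<^sup>2"
      by (rule sum_squares_bound)
    moreover have "0 \<le> norm (f x) * norm (g x)" by simp
    ultimately show ?thesis by linarith
  qed
  then show "AE x in lebesgue_on \<Omega>. norm (f x \<bullet> g x) \<le> norm ((norm (f x))\<^sup>2 + (norm (g x))\<^sup>2)"
    by simp
qed

lemma L2_norm_nonneg: "0 \<le> L2_norm \<Omega> f"
  by (simp add: L2_norm_def)

lemma L2_norm_squared: "(L2_norm \<Omega> f)\<^sup>2 = L2_inner \<Omega> f f"
  by (simp add: L2_norm_def L2_inner_def power2_norm_eq_inner)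

lemma L2_inner_commute: "L2_inner \<Omega> f g = L2_inner \<Omega> g f"
  by (simp add: L2_inner_def inner_commute)

lemma L2_inner_diff_left:
  assumes "f \<in> L2 \<Omega>" "g \<in> L2 \<Omega>" "h \<in> L2 \<Omega>"
  shows "L2_inner \<Omega> (\<lambda>x. f x - g x) h = L2_inner \<Omega> f h - L2_inner \<Omega> g h"
  using assms by (simp add: L2_inner_def inner_diff_left L2_inner_integrable)

lemma L2_inner_diff_right:
  assumes "f \<in> L2 \<Omega>" "g \<in> L2 \<Omega>" "h \<in> L2 \<Omega>"
  shows "L2_inner \<Omega> h (\<lambda>x. f x - g x) = L2_inner \<Omega> h f - L2_inner \<Omega> h g"
  using assms by (simp add: L2_inner_def inner_diff_right L2_inner_integrable)

text \<open>The squared norm of \<open>f - s g\<close> is a nonnegative quadratic in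
  \<open>s\<close>, which bounds its discriminant.\<close>

lemma L2_Cauchy_Schwarz:
  assumes f: "f \<in> L2 \<Omega>" and g: "g \<in> L2 \<Omega>"
  shows "L2_inner \<Omega> f g \<le> L2_norm \<Omega> f * L2_norm \<Omega> g"
proof -
  define a b c where "a = L2_inner \<Omega> f f" "b = L2_inner \<Omega> f g" "c = L2_inner \<Omega> g g"
  have quad: "0 \<le> a - 2 * s * b + s\<^sup>2 * c" for s
  proof -
    have "0 \<le> (LINT x|lebesgue_on \<Omega>. (f x - s *\<^sub>R g x) \<bullet> (f x - s *\<^sub>R g x))"
      by (intro Bochner_Integration.integral_nonneg) simp
    also have "\<dots> = (LINT x|lebesgue_on \<Omega>. f x \<bullet> f x - (2 * s) * (f x \<bullet> g x) + s\<^sup>2 * (g x \<bullet> g x))"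
      by (intro Bochner_Integration.integral_cong)
        (auto simp: inner_diff_left inner_diff_right inner_commute power2_eq_square algebra_simps)
    also have "\<dots> = a - 2 * s * b + s\<^sup>2 * c"
      using L2_inner_integrable[OF f f] L2_inner_integrable[OF f g] L2_inner_integrable[OF g g]
      by (simp add: a_b_c_def L2_inner_def)
    finally show ?thesis .
  qed
  have nonneg: "0 \<le> a" "0 \<le> c"
    by (auto simp: a_b_c_def L2_inner_def intro!: Bochner_Integration.integral_nonneg)
  have "b\<^sup>2 \<le> a * c"
  proof (cases "c = 0")
    case True
    \<comment> \<open>With \<open>c = 0\<close> the quadratic is affine in \<open>s\<close>; for
      nonzero \<open>b\<close> this choice of \<open>s\<close> would give it the value -1.\<close>
    have "b = 0"
      using quad[of "(a + 1) / (2 * b)"] True nonneg by (cases "b = 0") auto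
    with nonneg show ?thesis by simp
  next
    case False
    with nonneg have "c > 0" by simp
    \<comment> \<open>\<open>b / c\<close> minimizes the quadratic.\<close>
    with quad[of "b / c"] show ?thesis
      by (simp add: field_simps power2_eq_square)
  qed
  then have "\<bar>b\<bar> \<le> sqrt (a * c)"
    using real_le_rsqrt real_sqrt_abs real_sqrt_le_mono by metis
  then show ?thesis
    by (simp add: a_b_c_def L2_norm_def L2_inner_def real_sqrt_mult power2_norm_eq_inner)
qed

lemma L2_vec_nth:
  assumes "f \<in> L2 \<Omega>"
  shows "(\<lambda>x. f x $ i) \<in> L2 \<Omega>"
proof (rule L2_of_bound[OF assms, where c = 1])
  have "(\<lambda>y. y $ i) \<in> borel_measurable borel"
    by (intro borel_measurable_continuous_onI continuous_intros)
  then show "(\<lambda>x. f x $ i) \<in> borel_measurable (lebesgue_on \<Omega>)"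
    using assms by (auto simp: L2_def intro: measurable_compose)
qed (simp add: Finite_Cartesian_Product.norm_nth_le)

lemma L2_continuous:
  fixes f :: "real^'n \<Rightarrow> 'b::euclidean_space"
  assumes "bounded \<Omega>" "open \<Omega>" "continuous_on UNIV f"
  shows "f \<in> L2 \<Omega>"
proof -
  have m: "f \<in> borel_measurable (lebesgue_on \<Omega>)"
    using assms by (intro continuous_imp_measurable_on_sets_lebesgue) (auto intro: continuous_on_subset)
  have "compact (f ` closure \<Omega>)"
    using assms by (intro compact_continuous_image) (auto intro: continuous_on_subset)
  then have "bounded (f ` closure \<Omega>)" by (rule compact_imp_bounded)
  then obtain B where B: "\<And>x. x \<in> closure \<Omega> \<Longrightarrow> norm (f x) \<le> B"
    unfolding bounded_iff by blast
  have "integrable (lebesgue_on \<Omega>) (\<lambda>x. (norm (f x))\<^sup>2)"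
  proof (rule Bochner_Integration.integrable_bound)
    have "\<Omega> \<in> lmeasurable"
      using assms by (intro lmeasurable_open)
    then show "integrable (lebesgue_on \<Omega>) (\<lambda>x. B\<^sup>2)"
      by (auto simp: fmeasurable_def emeasure_restrict_space intro!: integrable_const
          finite_measure.integrable_const finite_measureI)
    show "AE x in lebesgue_on \<Omega>. norm ((norm (f x))\<^sup>2) \<le> norm (B\<^sup>2)"
    proof (rule AE_I2)
      fix x assume "x \<in> space (lebesgue_on \<Omega>)"
      then have "norm (f x) \<le> B"
        using B closure_subset[of \<Omega>] by auto
      then show "norm ((norm (f x))\<^sup>2) \<le> norm (B\<^sup>2)"
        by (simp add: power_mono)
    qed
  qed (use m in measurable)
  with m show ?thesis by (simp add: L2_def)
qed

lemma integral_lebesgue_on_support: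
  fixes f :: "'a::euclidean_space \<Rightarrow> real"
  assumes "U \<subseteq> \<Omega>" "U \<in> sets lebesgue" "\<Omega> \<in> sets lebesgue"
    and "\<And>x. x \<in> \<Omega> \<Longrightarrow> x \<notin> U \<Longrightarrow> f x = 0"
  shows "(LINT x|lebesgue_on \<Omega>. f x) = (LINT x|lebesgue_on U. f x)"
proof -
  have "(LINT x|lebesgue. indicator \<Omega> x *\<^sub>R f x) = (LINT x|lebesgue. indicator U x *\<^sub>R f x)"
    using assms by (intro Bochner_Integration.integral_cong) (auto simp: indicator_def)
  then show ?thesis
    using assms by (simp add: integral_restrict_space)
qed

lemma L2_subset:
  assumes "f \<in> L2 \<Omega>" "U \<subseteq> \<Omega>" "U \<in> sets lebesgue" "\<Omega> \<in> sets lebesgue"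
  shows "f \<in> L2 U"
proof -
  have U: "lebesgue_on U = restrict_space (lebesgue_on \<Omega>) U"
    using assms by (simp add: restrict_restrict_space Int_absorb1)
  have Um: "U \<in> sets (lebesgue_on \<Omega>)"
    using assms by (auto simp: sets_restrict_space)
  then have "U \<inter> space (lebesgue_on \<Omega>) \<in> sets (lebesgue_on \<Omega>)" by blast
  moreover have "integrable (lebesgue_on \<Omega>) (\<lambda>x. indicator U x *\<^sub>R (norm (f x))\<^sup>2)"
    using assms(1) by (intro integrable_mult_indicator Um) (simp add: L2_def)
  ultimately have "integrable (restrict_space (lebesgue_on \<Omega>) U) (\<lambda>x. (norm (f x))\<^sup>2)"
    by (simp only: integrable_restrict_space)
  moreover have "f \<in> borel_measurable (restrict_space (lebesgue_on \<Omega>) U)"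
    using assms(1) unfolding L2_def by (blast intro: measurable_restrict_space1)
  ultimately show ?thesis
    unfolding L2_def U by simp
qed

section \<open>Weak gradients\<close>

lemma weak_gradient_works: "v \<in> H1 \<Omega> \<Longrightarrow> is_weak_gradient \<Omega> v (weak_gradient \<Omega> v)"
  by (simp add: H1_def weak_gradient_def some_eq_ex)

lemma weak_gradient_L2: "v \<in> H1 \<Omega> \<Longrightarrow> weak_gradient \<Omega> v \<in> L2 \<Omega>"
  using weak_gradient_works by (auto simp: is_weak_gradient_def)

text \<open>The fundamental lemma, used componentwise. \<open>G\<close> lives on \<Omega> and
  \<open>H\<close> only on \<open>U\<close>: the case \<open>U = \<Omega>\<close> yields uniqueness
  of weak gradients, a smaller \<open>U\<close> their local identification.\<close>

lemma tensor_eq_of_test_functions: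
  fixes G H :: "real^'d \<Rightarrow> real^'d^'d"
  assumes \<Omega>: "open \<Omega>" "bounded \<Omega>" and U: "open U" "U \<subseteq> \<Omega>"
    and G: "G \<in> L2 \<Omega>" and H: "H \<in> L2 U"
    and test: "\<And>\<phi> i j. \<phi> \<in> test_functions U \<Longrightarrow>
      (LINT x|lebesgue_on \<Omega>. G x $ i $ j * \<phi> x) = (LINT x|lebesgue_on U. H x $ i $ j * \<phi> x)"
  shows "AE x in lebesgue_on U. G x = H x"
proof -
  have bU: "bounded U" using \<Omega> U bounded_subset by blast
  have GU: "G \<in> L2 U"
    using \<Omega> U by (intro L2_subset[OF G]) auto
  have "AE x in lebesgue_on U. G x $ i $ j - H x $ i $ j = 0" for i j
  proof (rule fundamental_lemma[OF U(1)])
    have L: "(\<lambda>x. G x $ i $ j) \<in> L2 U" "(\<lambda>x. H x $ i $ j) \<in> L2 U"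
      using GU H by (auto intro: L2_vec_nth)
    \<comment> \<open>Continuous functions are square integrable on a bounded open set; the constant
      1 then gives integrability of the components themselves.\<close>
    have int: "integrable (lebesgue_on U) (\<lambda>x. f x * \<phi> x)"
      if "f \<in> L2 U" "continuous_on UNIV \<phi>" for f \<phi> :: "real^'d \<Rightarrow> real"
      using L2_inner_integrable[OF that(1) L2_continuous[OF bU U(1) that(2)]] by simp
    show "integrable (lebesgue_on U) (\<lambda>x. G x $ i $ j - H x $ i $ j)"
      using int[OF L(1), of "\<lambda>_. 1"] int[OF L(2), of "\<lambda>_. 1"] by simp
    fix \<phi> assume \<phi>: "\<phi> \<in> test_functions U"
    have "(LINT x|lebesgue_on U. G x $ i $ j * \<phi> x) = (LINT x|lebesgue_on \<Omega>. G x $ i $ j * \<phi> x)"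
      using \<Omega> U test_functionsD(4)[OF \<phi>]
      by (intro integral_lebesgue_on_support[symmetric]) auto
    then show "(LINT x|lebesgue_on U. (G x $ i $ j - H x $ i $ j) * \<phi> x) = 0"
      using int[OF L(1), of \<phi>] int[OF L(2), of \<phi>] test[OF \<phi>] test_functionsD(2)[OF \<phi>]
      by (simp add: left_diff_distrib)
  qed
  then have "AE x in lebesgue_on U. \<forall>i j. G x $ i $ j - H x $ i $ j = 0"
    by (simp add: AE_all_countable)
  then show ?thesis
    by eventually_elim (simp add: vec_eq_iff)
qed

lemma is_weak_gradient_unique:
  assumes "open \<Omega>" "bounded \<Omega>" "is_weak_gradient \<Omega> v G" "is_weak_gradient \<Omega> v H"
  shows "AE x in lebesgue_on \<Omega>. G x = H x"
proof (rule tensor_eq_of_test_functions)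
  fix \<phi> i j assume "\<phi> \<in> test_functions \<Omega>"
  then show "(LINT x|lebesgue_on \<Omega>. G x $ i $ j * \<phi> x) = (LINT x|lebesgue_on \<Omega>. H x $ i $ j * \<phi> x)"
    using assms(3,4) by (simp add: is_weak_gradient_def)
qed (use assms in \<open>auto simp: is_weak_gradient_def\<close>)

text \<open>Test functions on \<open>U\<close> are test functions on \<Omega>. The integral is
  shrunk to \<open>U\<close>, where \<open>v\<close> may be replaced by its affine formula, and then
  enlarged to the whole space, where \<open>affine_integration_by_parts\<close> applies.\<close>

lemma is_weak_gradient_affine_on:
  fixes A :: "real^'d^'d"
  assumes \<Omega>: "open \<Omega>" "bounded \<Omega>" and U: "open U" "U \<subseteq> \<Omega>"
    and G: "is_weak_gradient \<Omega> v G" and v: "\<And>x. x \<in> U \<Longrightarrow> v x = A *v x + b"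
  shows "AE x in lebesgue_on U. G x = A"
proof (rule tensor_eq_of_test_functions[OF \<Omega> U])
  show "G \<in> L2 \<Omega>" using G by (simp add: is_weak_gradient_def)
  show "(\<lambda>x. A) \<in> L2 U"
    using \<Omega> U bounded_subset by (intro L2_continuous) auto
  fix \<phi> i j assume \<phi>: "\<phi> \<in> test_functions U"
  then have "\<phi> \<in> test_functions \<Omega>" using test_functions_mono[OF U(2)] by blast
  then have "- (LINT x|lebesgue_on \<Omega>. G x $ i $ j * \<phi> x) = (LINT x|lebesgue_on \<Omega>. v x $ i * partial_deriv j \<phi> x)"
    using G by (simp add: is_weak_gradient_def)
  also have "\<dots> = (LINT x|lebesgue_on U. v x $ i * partial_deriv j \<phi> x)"
    using \<Omega> U test_partial_deriv_outside[OF \<phi>] by (intro integral_lebesgue_on_support) auto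
  also have "\<dots> = (LINT x|lebesgue_on U. (A *v x + b) $ i * partial_deriv j \<phi> x)"
    using v by (intro Bochner_Integration.integral_cong) auto
  also have "\<dots> = (LINT x|lebesgue_on UNIV. (A *v x + b) $ i * partial_deriv j \<phi> x)"
    using U test_partial_deriv_outside[OF \<phi>] by (intro integral_lebesgue_on_support[symmetric]) auto
  also have "\<dots> = (LINT x|lebesgue_on UNIV. - (A $ i $ j * \<phi> x))"
    unfolding lebesgue_on_UNIV_eq by (rule affine_integration_by_parts[OF \<phi>])
  also have "\<dots> = (LINT x|lebesgue_on U. - (A $ i $ j * \<phi> x))"
    using U test_functionsD(4)[OF \<phi>] by (intro integral_lebesgue_on_support) auto
  finally show "(LINT x|lebesgue_on \<Omega>. G x $ i $ j * \<phi> x) = (LINT x|lebesgue_on U. A $ i $ j * \<phi> x)"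
    by simp
qed

lemma is_weak_gradient_diff:
  assumes \<Omega>: "open \<Omega>" "bounded \<Omega>" and L: "v \<in> L2 \<Omega>" "w \<in> L2 \<Omega>"
    and G: "is_weak_gradient \<Omega> v G" "is_weak_gradient \<Omega> w H"
  shows "is_weak_gradient \<Omega> (\<lambda>x. v x - w x) (\<lambda>x. G x - H x)"
  unfolding is_weak_gradient_def
proof (intro conjI ballI allI)
  have GH: "G \<in> L2 \<Omega>" "H \<in> L2 \<Omega>" using G by (auto simp: is_weak_gradient_def)
  then show "(\<lambda>x. G x - H x) \<in> L2 \<Omega>" by (rule L2_diff)
  fix \<phi> i j assume \<phi>: "\<phi> \<in> test_functions \<Omega>"
  have int: "integrable (lebesgue_on \<Omega>) (\<lambda>x. f x * \<psi> x)"
    if "f \<in> L2 \<Omega>" "continuous_on UNIV \<psi>" for f \<psi> :: "real^'a \<Rightarrow> real"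
    using L2_inner_integrable[OF that(1) L2_continuous[OF \<Omega>(2,1) that(2)]] by simp
  note T = test_functionsD(2,6)[OF \<phi>]
  have "(LINT x|lebesgue_on \<Omega>. (v x - w x) $ i * partial_deriv j \<phi> x) =
      (LINT x|lebesgue_on \<Omega>. v x $ i * partial_deriv j \<phi> x) - (LINT x|lebesgue_on \<Omega>. w x $ i * partial_deriv j \<phi> x)"
    using int[OF L2_vec_nth[OF L(1)] T(2)] int[OF L2_vec_nth[OF L(2)] T(2)]
    by (simp add: left_diff_distrib)
  also have "\<dots> = - ((LINT x|lebesgue_on \<Omega>. G x $ i $ j * \<phi> x) - (LINT x|lebesgue_on \<Omega>. H x $ i $ j * \<phi> x))"
    using G \<phi> by (simp add: is_weak_gradient_def)
  also have "\<dots> = - (LINT x|lebesgue_on \<Omega>. (G x - H x) $ i $ j * \<phi> x)"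
    using int[OF L2_vec_nth[OF L2_vec_nth[OF GH(1)]] T(1)] int[OF L2_vec_nth[OF L2_vec_nth[OF GH(2)]] T(1)]
    by (simp add: left_diff_distrib)
  finally show "(LINT x|lebesgue_on \<Omega>. (v x - w x) $ i * partial_deriv j \<phi> x) =
    - (LINT x|lebesgue_on \<Omega>. (G x - H x) $ i $ j * \<phi> x)" .
qed

lemma H1_diff:
  assumes \<Omega>: "open \<Omega>" "bounded \<Omega>" and v: "v \<in> H1 \<Omega>" and w: "w \<in> H1 \<Omega>"
  shows "(\<lambda>x. v x - w x) \<in> H1 \<Omega>"
proof -
  have L: "v \<in> L2 \<Omega>" "w \<in> L2 \<Omega>" using v w by (auto simp: H1_def)
  show ?thesis
    using L2_diff[OF L] is_weak_gradient_diff[OF \<Omega> L weak_gradient_works[OF v] weak_gradient_works[OF w]]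
    by (auto simp: H1_def)
qed

text \<open>\<open>weak_gradient\<close> is an arbitrary choice, so linearity holds only up to null
  sets: the difference of the chosen gradients is a weak gradient of the difference, and uniqueness
  applies.\<close>

lemma strain_diff:
  assumes \<Omega>: "open \<Omega>" "bounded \<Omega>" and v: "v \<in> H1 \<Omega>" and w: "w \<in> H1 \<Omega>"
  shows "AE x in lebesgue_on \<Omega>. strain \<Omega> (\<lambda>x. v x - w x) x = strain \<Omega> v x - strain \<Omega> w x"
proof -
  have L: "v \<in> L2 \<Omega>" "w \<in> L2 \<Omega>" using v w by (auto simp: H1_def)
  have D: "is_weak_gradient \<Omega> (\<lambda>x. v x - w x) (\<lambda>x. weak_gradient \<Omega> v x - weak_gradient \<Omega> w x)"
    by (intro is_weak_gradient_diff \<Omega> L weak_gradient_works v w)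
  from is_weak_gradient_unique[OF \<Omega> weak_gradient_works[OF H1_diff[OF \<Omega> v w]] D]
  show ?thesis
  proof eventually_elim
    case (elim x)
    then show ?case
      unfolding strain_def elim by (simp add: vec_eq_iff transpose_def field_simps)
  qed
qed

section \<open>Integrability of strains, and piecewise constant strains on simplices\<close>

lemma norm_transpose: "norm (transpose A) = norm (A :: real^'n^'m)"
proof -
  have "transpose A \<bullet> transpose A = A \<bullet> A"
    unfolding inner_vec_def transpose_def by (simp, rule sum.swap)
  then show ?thesis by (simp add: norm_eq_sqrt_inner)
qed

lemma strain_L2_sym:
  assumes "v \<in> H1 \<Omega>"
  shows "strain \<Omega> v \<in> L2_sym \<Omega>"
proof -
  define G where "G = weak_gradient \<Omega> v"
  have G: "G \<in> L2 \<Omega>" unfolding G_def by (rule weak_gradient_L2[OF assms])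
  have "(\<lambda>x. (1/2) *\<^sub>R (G x + transpose (G x))) \<in> L2 \<Omega>"
  proof (rule L2_of_bound[OF G, where c = 1])
    have "(\<lambda>Y :: real^'a^'a. (1/2) *\<^sub>R (Y + transpose Y)) \<in> borel_measurable borel"
      unfolding transpose_def by (intro borel_measurable_continuous_onI continuous_intros)
    then show "(\<lambda>x. (1/2) *\<^sub>R (G x + transpose (G x))) \<in> borel_measurable (lebesgue_on \<Omega>)"
      using G by (auto simp: L2_def intro: measurable_compose)
    show "norm ((1/2) *\<^sub>R (G x + transpose (G x))) \<le> 1 * norm (G x)" for x
      using norm_triangle_ineq[of "G x" "transpose (G x)"] by (simp add: norm_transpose)
  qed
  then show ?thesis
    by (auto simp: L2_sym_def strain_def[abs_def] G_def transpose_def vec_eq_iff)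
qed

text \<open>The finitely many polytopes forming the frontier have dimension d - 1, hence empty
  interior, so each equals its own frontier, and frontiers of convex sets are null.\<close>

lemma negligible_polytopal_frontier:
  assumes "polytopal_domain \<Omega>"
  shows "negligible (frontier \<Omega>)"
proof -
  obtain \<F> where F: "finite \<F>" "\<And>P. P \<in> \<F> \<Longrightarrow> polytope P \<and> aff_dim P = int CARD('a) - 1"
    "frontier \<Omega> = \<Union>\<F>"
    using assms by (auto simp: polytopal_domain_def)
  have "negligible P" if "P \<in> \<F>" for P
  proof -
    have "interior P = {}"
      using F(2)[OF that] by (intro low_dim_interior) auto
    moreover have "closed P" "convex P"
      using F(2)[OF that] by (auto intro: polytope_imp_closed polytope_imp_convex)
    ultimately show ?thesis
      using negligible_convex_frontier[of P] by (simp add: frontier_def)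
  qed
  then show ?thesis
    using F by (auto intro: negligible_Union)
qed

text \<open>Inside both \<open>K\<close> and \<Omega> the weak gradient is the matrix of the affine
  formula; the rest of \<open>K\<close> lies in the frontiers of \<open>K\<close> and \<Omega>, both
  null.\<close>

lemma strain_P1_in_P0:
  assumes \<Omega>: "polytopal_domain \<Omega>" and mesh: "simplicial_mesh \<Omega> \<T>" and v: "v \<in> P1_vectors \<Omega> \<T>"
  shows "strain \<Omega> v \<in> P0_tensors \<Omega> \<T>"
proof -
  have dom: "open \<Omega>" "bounded \<Omega>" using \<Omega> by (auto simp: polytopal_domain_def)
  have vH: "v \<in> H1 \<Omega>" using v by (auto simp: P1_vectors_def H10_def)
  have "\<exists>C. AE x in lebesgue_on K. strain \<Omega> v x = C" if K: "K \<in> \<T>" for K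
  proof -
    have "\<forall>K\<in>\<T>. \<exists>A b. \<forall>x\<in>K. v x = A *v x + b" using v by (simp add: P1_vectors_def)
    with K obtain A b where v_eq: "\<And>x. x \<in> K \<Longrightarrow> v x = A *v x + b" by blast
    have simp: "int CARD('a) simplex K" and sub: "K \<subseteq> closure \<Omega>"
      using mesh K by (auto simp: simplicial_mesh_def)
    have K_props: "closed K" "convex K"
      using simp by (auto intro: closed_simplex convex_simplex)
    \<comment> \<open>The intersection matters: a polytopal domain may have slits, so that \<open>interior K\<close> need
      not be contained in \<open>\<Omega>\<close>.\<close>
    define U where "U = interior K \<inter> \<Omega>"
    have U: "open U" "U \<subseteq> \<Omega>" "U \<subseteq> K" using dom interior_subset by (auto simp: U_def)
    have "AE x in lebesgue_on U. weak_gradient \<Omega> v x = A"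
      using U v_eq by (intro is_weak_gradient_affine_on[OF dom U(1,2) weak_gradient_works[OF vH]]) auto
    then have "AE x in lebesgue. x \<in> U \<longrightarrow> weak_gradient \<Omega> v x = A"
      using U by (subst (asm) AE_restrict_space_iff) auto
    moreover have "AE x in lebesgue. x \<notin> frontier K"
      using negligible_convex_frontier[OF K_props(2)]
      by (intro AE_not_in) (simp add: negligible_iff_null_sets)
    moreover have "AE x in lebesgue. x \<notin> frontier \<Omega>"
      using negligible_polytopal_frontier[OF \<Omega>]
      by (intro AE_not_in) (simp add: negligible_iff_null_sets)
    ultimately have "AE x in lebesgue. x \<in> K \<longrightarrow> strain \<Omega> v x = (1/2) *\<^sub>R (A + transpose A)"
    proof eventually_elim
      case (elim x)
      then show ?case
        using sub K_props(1) dom(1)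
        by (auto simp: U_def strain_def frontier_def interior_open closure_closed)
    qed
    then have "AE x in lebesgue_on K. strain \<Omega> v x = (1/2) *\<^sub>R (A + transpose A)"
      using K_props(1) by (subst AE_restrict_space_iff) auto
    then show ?thesis by blast
  qed
  with strain_L2_sym[OF vH] show ?thesis by (simp add: P0_tensors_def)
qed

section \<open>The constitutive map\<close>

text \<open>The nonlinear part of the constitutive law. By the first equation
  \<open>T / n + stress lam \<mu> T\<close> is weakly the strain of \<open>u\<close>: the argument
  is the stress tensor, the value a contribution to the strain.\<close>

definition stress :: "(real \<Rightarrow> real) \<Rightarrow> (real \<Rightarrow> real) \<Rightarrow> real^'d^'d \<Rightarrow> real^'d^'d" where
  "stress lam \<mu> A = (lam (trace A) * trace A) *\<^sub>R mat 1 + \<mu> (norm (deviator A)) *\<^sub>R deviator A"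

lemma form_c_stress: "form_c lam \<mu> \<Omega> T T S = L2_inner \<Omega> (\<lambda>x. stress lam \<mu> (T x)) S"
  by (simp add: form_c_def L2_inner_def stress_def)

text \<open>Monotonicity gives both increments the same sign, so their product equals that of the
  absolute values; the Lipschitz bound is then applied to one factor of the square.\<close>

lemma monotone_lipschitz_cocoercive:
  fixes g :: "real \<Rightarrow> real"
  assumes "mono_on S g" "\<bar>g a - g b\<bar> \<le> L * \<bar>a - b\<bar>" "a \<in> S" "b \<in> S"
  shows "(g a - g b)\<^sup>2 \<le> L * ((g a - g b) * (a - b))"
proof -
  have "(g a - g b) * (a - b) = \<bar>g a - g b\<bar> * \<bar>a - b\<bar>"
    using mono_onD[OF assms(1), of a b] mono_onD[OF assms(1), of b a] assms(3,4)
    by (cases "a \<le> b") (auto simp: abs_if mult_nonpos_nonpos algebra_simps)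
  moreover have "(g a - g b)\<^sup>2 = \<bar>g a - g b\<bar> * \<bar>g a - g b\<bar>"
    by (simp add: power2_eq_square)
  ultimately show ?thesis
    using mult_left_mono[OF assms(2), of "\<bar>g a - g b\<bar>"] by (simp add: ac_simps)
qed

text \<open>With \<open>p = m (norm D)\<close>, \<open>q = m (norm E)\<close> and \<open>z = norm D * norm E - D \<bullet> E\<close> the radial parts
  contribute as in one dimension, and the angular parts are \<open>2 * p * q * z\<close> on the left and
  \<open>(p + q) * z\<close> on the right.\<close>
lemma radial_cocoercive:
  fixes D E :: "'a::real_inner" and m :: "real \<Rightarrow> real"
  assumes mono: "mono_on {0..} (\<lambda>s. m s * s)"
    and lip: "\<And>s t. 0 \<le> s \<Longrightarrow> 0 \<le> t \<Longrightarrow> \<bar>m s * s - m t * t\<bar> \<le> L * \<bar>s - t\<bar>"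
    and m: "\<And>s. s > 0 \<Longrightarrow> 0 \<le> m s"
  shows "(norm (m (norm D) *\<^sub>R D - m (norm E) *\<^sub>R E))\<^sup>2 \<le>
    L * ((m (norm D) *\<^sub>R D - m (norm E) *\<^sub>R E) \<bullet> (D - E))"
proof -
  define s t p q z where "s = norm D" "t = norm E" "p = m s" "q = m t" "z = s * t - D \<bullet> E"
  note defs = this
  have norms: "D \<bullet> D = s * s" "E \<bullet> E = t * t" "E \<bullet> D = s * t - z" "D \<bullet> E = s * t - z"
    by (auto simp: defs power2_eq_square simp flip: power2_norm_eq_inner inner_commute[of D E])
  have lhs: "(norm (p *\<^sub>R D - q *\<^sub>R E))\<^sup>2 = (p * s - q * t)\<^sup>2 + 2 * (p * q) * z"
    unfolding power2_norm_eq_inner inner_diff_left inner_diff_right inner_scaleR_left inner_scaleR_right norms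
    by (simp add: power2_eq_square algebra_simps)
  have rhs: "(p *\<^sub>R D - q *\<^sub>R E) \<bullet> (D - E) = (p * s - q * t) * (s - t) + (p + q) * z"
    unfolding inner_diff_left inner_diff_right inner_scaleR_left inner_scaleR_right norms
    by (simp add: algebra_simps)
  have radial: "(p * s - q * t)\<^sup>2 \<le> L * ((p * s - q * t) * (s - t))"
    using monotone_lipschitz_cocoercive[OF mono lip, of s t] by (simp add: defs)
  \<comment> \<open>Comparing with \<open>t = 0\<close>, where \<open>m t * t\<close> vanishes,
    gives \<open>m r * r \<le> L * r\<close>.\<close>
  have bnd: "0 \<le> m r \<and> m r \<le> L" if "r > 0" for r
    using lip[of r 0] that m[OF that] by (simp add: abs_mult)
  have z: "0 \<le> z" using norm_cauchy_schwarz[of D E] by (simp add: defs)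
  have "2 * (p * q) * z \<le> L * ((p + q) * z)"
  \<comment> \<open>The value \<open>m 0\<close> is not controlled, but \<open>z = 0\<close> when
    either vector vanishes.\<close>
  proof (cases "D = 0 \<or> E = 0")
    case True
    then have "z = 0" by (auto simp: defs)
    then show ?thesis by simp
  next
    case False
    then have "0 \<le> p" "p \<le> L" "0 \<le> q" "q \<le> L" using bnd by (auto simp: defs)
    then have "p * q \<le> p * L" "p * q \<le> L * q"
      by (auto intro: mult_left_mono mult_right_mono)
    then have "2 * (p * q) \<le> L * (p + q)" by (simp add: algebra_simps)
    from mult_right_mono[OF this z] show ?thesis by (simp add: ac_simps)
  qed
  with radial have "(norm (p *\<^sub>R D - q *\<^sub>R E))\<^sup>2 \<le> L * ((p *\<^sub>R D - q *\<^sub>R E) \<bullet> (D - E))"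
    unfolding lhs rhs by (simp add: distrib_left)
  then show ?thesis by (simp add: defs)
qed

text \<open>The monotonicity comes from nonnegative derivatives, the sign of \<mu> from the lower
  growth bound on \<open>\<mu> s * s\<^sup>2\<close>.\<close>

lemma material_mono:
  assumes "material_functions C\<^sub>1 C\<^sub>2 \<kappa> \<alpha> lam \<mu>"
  shows "mono_on UNIV (\<lambda>s. lam s * s)" "mono_on {0..} (\<lambda>s. \<mu> s * s)" "s > 0 \<Longrightarrow> 0 \<le> \<mu> s"
proof -
  note M = assms[unfolded material_functions_def]
  show "mono_on UNIV (\<lambda>s. lam s * s)"
  proof (rule mono_onI)
    fix r s :: real assume "r \<le> s"
    moreover have "((\<lambda>s. lam s * s) has_real_derivative deriv (\<lambda>s. lam s * s) x) (at x)" for x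
    proof -
      obtain D where "((\<lambda>s. lam s * s) has_vector_derivative D) (at x)"
        using M unfolding C1_differentiable_on_def by blast
      then show ?thesis
        by (metis DERIV_imp_deriv has_real_derivative_iff_has_vector_derivative)
    qed
    ultimately show "lam r * r \<le> lam s * s"
      using M by (intro DERIV_nonneg_imp_nondecreasing[of r s "\<lambda>s. lam s * s"]) blast+
  qed
  show "mono_on {0..} (\<lambda>s. \<mu> s * s)"
  proof (rule mono_onI)
    fix r s :: real assume rs: "r \<in> {0..}" "s \<in> {0..}" "r \<le> s"
    \<comment> \<open>\<open>r\<close> may be 0, where no derivative is assumed; derivatives on the
      open interval and continuity up to its ends suffice.\<close>
    have der: "\<exists>y. ((\<lambda>s. \<mu> s * s) has_real_derivative y) (at x) \<and> 0 \<le> y" if "r < x" for x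
    proof -
      have x: "0 < x" using that rs by simp
      then have "(\<lambda>s. \<mu> s * s) differentiable (at x)" "C\<^sub>1 / (\<kappa> + x) powr (\<alpha> + 1) \<le> deriv (\<lambda>s. \<mu> s * s) x"
        using M by auto
      moreover have "0 \<le> C\<^sub>1 / (\<kappa> + x) powr (\<alpha> + 1)" using M by simp
      ultimately show ?thesis
        by (auto simp: real_differentiable_def DERIV_imp_deriv)
    qed
    have "continuous_on {0..} \<mu>" using M by blast
    then have "continuous_on {r..s} \<mu>"
      by (rule continuous_on_subset) (use rs(1) in auto)
    then have "continuous_on {r..s} (\<lambda>s. \<mu> s * s)"
      by (intro continuous_intros)
    with der show "\<mu> r * r \<le> \<mu> s * s"
      using DERIV_nonneg_imp_increasing_open[OF rs(3), of "\<lambda>s. \<mu> s * s"] by simp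
  qed
  assume s: "s > 0"
  then have "0 \<le> C\<^sub>1 * s\<^sup>2 / (\<kappa> + s)" using M by simp
  also have "\<dots> \<le> \<mu> s * s\<^sup>2" using M s by simp
  finally show "0 \<le> \<mu> s" using s by (simp add: zero_le_mult_iff)
qed

section \<open>Orthogonal splitting into spherical and deviatoric parts\<close>

lemma inner_mat_1: "(mat 1 :: real^'d^'d) \<bullet> S = trace S"
proof -
  have "(mat 1 :: real^'d^'d) \<bullet> S = (\<Sum>i\<in>UNIV. \<Sum>j\<in>UNIV. if i = j then S $ i $ j else 0)"
    unfolding inner_vec_def mat_def by (intro sum.cong) auto
  then show ?thesis by (simp add: trace_def)
qed

lemma trace_mat_1: "trace (mat 1 :: real^'d^'d) = real CARD('d)"
  by (simp add: trace_def mat_def)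

lemma trace_scaleR: "trace (c *\<^sub>R A) = c * trace (A :: real^'d^'d)"
  by (simp add: trace_def sum_distrib_left)

lemma trace_deviator: "trace (deviator A) = 0"
  by (simp add: deviator_def trace_sub trace_scaleR trace_mat_1)

text \<open>The spherical and deviatoric parts are orthogonal and are treated separately. As
  \<open>I \<bullet> I = d\<close>, the spherical part has squared norm \<open>d * p\<^sup>2\<close>
  but pairing \<open>p * a\<close>, hence the factor d; the deviatoric part alone has constant
  \<Lambda>.\<close>

lemma stress_cocoercive:
  fixes A B :: "real^'d^'d"
  assumes material: "material_functions C\<^sub>1 C\<^sub>2 \<kappa> \<alpha> lam \<mu>"
    and lam: "\<forall>s t. \<bar>lam s * s - lam t * t\<bar> \<le> \<Lambda> * \<bar>t - s\<bar>"
    and mu: "\<forall>s\<ge>0. \<forall>t\<ge>0. \<bar>\<mu> s * s - \<mu> t * t\<bar> \<le> \<Lambda> * \<bar>t - s\<bar>"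
  shows "(norm (stress lam \<mu> A - stress lam \<mu> B))\<^sup>2 \<le>
    real CARD('d) * \<Lambda> * ((stress lam \<mu> A - stress lam \<mu> B) \<bullet> (A - B))"
proof -
  define I :: "real^'d^'d" where "I = mat 1"
  define d where "d = real CARD('d)"
  define p where "p = lam (trace A) * trace A - lam (trace B) * trace B"
  define F where "F = \<mu> (norm (deviator A)) *\<^sub>R deviator A - \<mu> (norm (deviator B)) *\<^sub>R deviator B"
  define a where "a = trace A - trace B"
  define D where "D = deviator A - deviator B"
  have \<sigma>: "stress lam \<mu> A - stress lam \<mu> B = p *\<^sub>R I + F"
    by (simp add: stress_def p_def F_def I_def algebra_simps)
  have AB: "A - B = (a / d) *\<^sub>R I + D"
    by (simp add: D_def deviator_def I_def a_def d_def algebra_simps diff_divide_distrib)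
  have d: "d \<ge> 1" by (simp add: d_def Suc_leI)
  have "trace F = 0" "trace D = 0"
    by (simp_all add: F_def D_def trace_sub trace_scaleR trace_deviator)
  then have orth: "I \<bullet> F = 0" "F \<bullet> I = 0" "I \<bullet> D = 0" "I \<bullet> I = d"
    using inner_commute[of F I] by (simp_all add: I_def inner_mat_1 trace_mat_1 d_def)
  have inner: "(p *\<^sub>R I + F) \<bullet> ((a / d) *\<^sub>R I + D) = p * a + F \<bullet> D"
    using d by (simp add: inner_add_left inner_add_right orth)
  have normsq: "(norm (p *\<^sub>R I + F))\<^sup>2 = d * p\<^sup>2 + (norm F)\<^sup>2"
    unfolding power2_norm_eq_inner by (simp add: inner_add_left inner_add_right orth power2_eq_square)
  have 1: "p\<^sup>2 \<le> \<Lambda> * (p * a)"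
    using monotone_lipschitz_cocoercive[OF material_mono(1)[OF material], of "trace A" "trace B" \<Lambda>] lam
    by (simp add: p_def a_def abs_minus_commute)
  have 2: "(norm F)\<^sup>2 \<le> \<Lambda> * (F \<bullet> D)"
    unfolding F_def D_def
    by (rule radial_cocoercive[OF material_mono(2)[OF material]])
      (use mu material_mono(3)[OF material] in \<open>auto simp: abs_minus_commute\<close>)
  \<comment> \<open>This sign permits enlarging the deviatoric constant from \<Lambda> to
    \<open>d * \<Lambda>\<close>.\<close>
  have "0 \<le> \<Lambda> * (F \<bullet> D)" using 2 zero_le_power2 order_trans by blast
  then have "\<Lambda> * (F \<bullet> D) \<le> d * (\<Lambda> * (F \<bullet> D))"
    using d mult_right_mono[of 1 d "\<Lambda> * (F \<bullet> D)"] by simp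
  moreover have "d * p\<^sup>2 \<le> d * (\<Lambda> * (p * a))"
    using d by (intro mult_left_mono 1) simp
  ultimately have "d * p\<^sup>2 + (norm F)\<^sup>2 \<le> d * (\<Lambda> * (p * a)) + d * (\<Lambda> * (F \<bullet> D))"
    using 2 by linarith
  then show ?thesis
    unfolding \<sigma> AB inner normsq d_def[symmetric] by (simp add: distrib_left mult.assoc)
qed

text \<open>Cauchy-Schwarz, then cancelling one factor \<open>norm x\<close>: cocoercivity implies
  Lipschitz continuity with the same constant.\<close>

lemma norm_le_of_cocoercive:
  fixes x y :: "'a::real_inner"
  assumes "(norm x)\<^sup>2 \<le> L * (x \<bullet> y)" "0 \<le> L"
  shows "norm x \<le> L * norm y"
proof (cases "x = 0")
  case False
  have "norm x * norm x \<le> norm x * (L * norm y)"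
    using assms(1) mult_left_mono[OF norm_cauchy_schwarz[of x y] assms(2)]
    by (simp add: power2_eq_square ac_simps)
  with False show ?thesis by simp
qed (use assms(2) in simp)

lemma stress_0: "stress lam \<mu> 0 = 0"
  by (simp add: stress_def deviator_def trace_def)

section \<open>The error estimate\<close>

text \<open>If the bound failed, \<open>m * x\<close> would exceed
  \<open>E + (m + 2 * \<Lambda>) * t\<close>, which forces \<open>x > t\<close>. Multiplying by
  \<open>x\<close> and using \<open>q\<close> then gives
  \<open>(m + 2 * \<Lambda>) * t * x < 3 / 4 * \<Lambda> * t\<^sup>2\<close>, impossible for
  \<open>x > t\<close>.\<close>

lemma quadratic_bound:
  fixes m x t E \<Lambda> :: real
  assumes "m > 0" "0 \<le> x" "0 \<le> t" "0 \<le> E" "0 < \<Lambda>" and q: "m * x\<^sup>2 \<le> x * E + 3 / 4 * \<Lambda> * t\<^sup>2"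
  shows "m * (x + t) \<le> E + 2 * (m + \<Lambda>) * t"
proof (rule ccontr)
  assume "\<not> ?thesis"
  then have neg: "m * x > E + (m + 2 * \<Lambda>) * t" by (simp add: algebra_simps)
  moreover have nn: "0 \<le> (m + 2 * \<Lambda>) * t" "0 \<le> \<Lambda> * t" using assms by simp_all
  ultimately have "m * x > 0" using assms(4) by linarith
  then have x: "x > 0" using assms by (simp add: zero_less_mult_iff)
  have "m * x > m * t" using neg nn assms(4) by (simp add: algebra_simps)
  then have xt: "t < x" using assms by simp
  have "x * (m * x) > x * (E + (m + 2 * \<Lambda>) * t)" using neg x by simp
  then have "(m + 2 * \<Lambda>) * t * x < 3 / 4 * \<Lambda> * t\<^sup>2"
    using q by (simp add: power2_eq_square algebra_simps)
  moreover have "\<Lambda> * t * t \<le> \<Lambda> * t * x" "0 \<le> m * t * x"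
    using xt nn assms by (auto intro: mult_left_mono)
  moreover have "0 \<le> \<Lambda> * t * t" using nn assms by simp
  ultimately show False by (simp add: power2_eq_square algebra_simps)
qed

lemma L2_inner_cong_AE:
  assumes "AE x in lebesgue_on \<Omega>. f x = g x" "f \<in> L2 \<Omega>" "g \<in> L2 \<Omega>" "h \<in> L2 \<Omega>"
  shows "L2_inner \<Omega> h f = L2_inner \<Omega> h g"
  unfolding L2_inner_def
proof (rule integral_cong_AE)
  show "AE x in lebesgue_on \<Omega>. h x \<bullet> f x = h x \<bullet> g x"
    using assms(1) by eventually_elim simp
qed (use assms in \<open>auto intro: borel_measurable_integrable L2_inner_integrable\<close>)

text \<open>The estimate for one fixed \<open>v\<close>, with abstract discrete spaces so that both
  kinds of elements are covered.\<close>

lemma mixed_error_estimate: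
  fixes \<Omega> :: "(real^'d) set" and T T\<^sub>h P :: "real^'d \<Rightarrow> real^'d^'d"
  assumes \<Omega>: "open \<Omega>" "bounded \<Omega>" and dim: "CARD('d) \<le> 3" and n: "n \<ge> 1" and \<Lambda>: "\<Lambda> > 0"
    and material: "material_functions C\<^sub>1 C\<^sub>2 \<kappa> \<alpha> lam \<mu>"
    and lam: "\<forall>s t. \<bar>lam s * s - lam t * t\<bar> \<le> \<Lambda> * \<bar>t - s\<bar>"
    and mu: "\<forall>s\<ge>0. \<forall>t\<ge>0. \<bar>\<mu> s * s - \<mu> t * t\<bar> \<le> \<Lambda> * \<bar>t - s\<bar>"
    and M: "M\<^sub>h \<subseteq> L2_sym \<Omega>" "\<And>R S. R \<in> M\<^sub>h \<Longrightarrow> S \<in> M\<^sub>h \<Longrightarrow> (\<lambda>x. R x - S x) \<in> M\<^sub>h"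
    and X: "X\<^sub>h \<subseteq> H10 \<Omega>" "\<And>v. v \<in> X\<^sub>h \<Longrightarrow> strain \<Omega> v \<in> M\<^sub>h"
    and P: "P \<in> M\<^sub>h" "\<And>S. S \<in> M\<^sub>h \<Longrightarrow> L2_inner \<Omega> (\<lambda>x. T x - P x) S = 0"
    and sol: "regularized_solution n lam \<mu> \<Omega> f (L2_sym \<Omega>) (H10 \<Omega>) T u"
    and sol\<^sub>h: "regularized_solution n lam \<mu> \<Omega> f M\<^sub>h X\<^sub>h T\<^sub>h u\<^sub>h"
    and v: "v \<in> X\<^sub>h"
  shows "1 / real n * L2_norm \<Omega> (\<lambda>x. T\<^sub>h x - T x) \<le>
    L2_norm \<Omega> (strain \<Omega> (\<lambda>x. v x - u x)) + 2 * (1 / real n + \<Lambda>) * L2_norm \<Omega> (\<lambda>x. T x - P x)"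
proof -
  note sols = sol[unfolded regularized_solution_def] sol\<^sub>h[unfolded regularized_solution_def]
  have T: "T \<in> L2_sym \<Omega>" "u \<in> H10 \<Omega>" "T\<^sub>h \<in> M\<^sub>h" "u\<^sub>h \<in> X\<^sub>h" using sols by auto
  have sub: "S \<in> L2 \<Omega>" if "S \<in> L2_sym \<Omega>" for S :: "real^'d \<Rightarrow> real^'d^'d" using that by (simp add: L2_sym_def)
  have H: "w \<in> H1 \<Omega>" if "w \<in> H10 \<Omega>" for w using that by (simp add: H10_def)
  define \<sigma> :: "real^'d^'d \<Rightarrow> real^'d^'d" where "\<sigma> = stress lam \<mu>"
  define m where "m = 1 / real n"
  define L where "L = real CARD('d) * \<Lambda>"
  define R where "R x = T\<^sub>h x - P x" for x
  define g where "g x = \<sigma> (T x) - \<sigma> (T\<^sub>h x)" for x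
  define x where "x = L2_norm \<Omega> R"
  define t where "t = L2_norm \<Omega> (\<lambda>x. T x - P x)"
  define E where "E = L2_norm \<Omega> (strain \<Omega> (\<lambda>x. v x - u x))"
  \<comment> \<open>The dimension bound enters here, and gives the factor 3/4 of
    \<open>quadratic_bound\<close> after division by 4.\<close>
  have L: "0 < L" "L \<le> 3 * \<Lambda>" using dim \<Lambda> by (auto simp: L_def)
  have coco: "(norm (\<sigma> A - \<sigma> B))\<^sup>2 \<le> L * ((\<sigma> A - \<sigma> B) \<bullet> (A - B))" for A B
    unfolding \<sigma>_def L_def by (rule stress_cocoercive[OF material lam mu])
  have lip: "norm (\<sigma> A - \<sigma> B) \<le> L * norm (A - B)" for A B
    by (rule norm_le_of_cocoercive[OF coco]) (use L in simp)
  \<comment> \<open>Continuity makes \<sigma> measurable; with \<open>\<sigma> 0 = 0\<close> the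
    Lipschitz bound also keeps compositions with \<sigma> in \<open>L2\<close>.\<close>
  have "L-lipschitz_on UNIV \<sigma>"
    using lip L by (intro lipschitz_onI) (auto simp: dist_norm)
  then have \<sigma>_meas: "\<sigma> \<in> borel_measurable borel"
    by (intro borel_measurable_continuous_onI lipschitz_on_continuous_on)
  have \<sigma>_L2: "(\<lambda>x. \<sigma> (S x)) \<in> L2 \<Omega>" if "S \<in> L2 \<Omega>" for S
  proof (rule L2_of_bound[OF that, where c = L])
    show "(\<lambda>x. \<sigma> (S x)) \<in> borel_measurable (lebesgue_on \<Omega>)"
      using that by (intro measurable_compose[OF _ \<sigma>_meas]) (simp add: L2_def)
    show "norm (\<sigma> (S x)) \<le> L * norm (S x)" for x
      using lip[of "S x" 0] by (simp add: \<sigma>_def stress_0)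
  qed
  have R_M: "R \<in> M\<^sub>h" unfolding R_def[abs_def] by (intro M(2) T P)
  have L2s: "T \<in> L2 \<Omega>" "T\<^sub>h \<in> L2 \<Omega>" "P \<in> L2 \<Omega>" "R \<in> L2 \<Omega>" "strain \<Omega> u \<in> L2 \<Omega>"
    "strain \<Omega> v \<in> L2 \<Omega>" "strain \<Omega> u\<^sub>h \<in> L2 \<Omega>"
    using T M(1) P(1) R_M X(1) v by (auto intro!: sub strain_L2_sym H)
  have H1: "v \<in> H1 \<Omega>" "u \<in> H1 \<Omega>" using T X(1) v by (auto intro: H)
  have D: "(\<lambda>x. T x - P x) \<in> L2 \<Omega>" "(\<lambda>x. T x - T\<^sub>h x) \<in> L2 \<Omega>" "g \<in> L2 \<Omega>"
    "(\<lambda>x. strain \<Omega> v x - strain \<Omega> u x) \<in> L2 \<Omega>" "strain \<Omega> (\<lambda>x. v x - u x) \<in> L2 \<Omega>"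
    unfolding g_def[abs_def] using L2s H1
    by (simp_all add: L2_diff \<sigma>_L2 sub strain_L2_sym H1_diff \<Omega>)
  have cont: "m * L2_inner \<Omega> T R + L2_inner \<Omega> (\<lambda>x. \<sigma> (T x)) R = L2_inner \<Omega> R (strain \<Omega> u)"
    using sols(1) R_M M(1) by (auto simp: form_a_def form_b_def form_c_stress m_def \<sigma>_def)
  have disc: "m * L2_inner \<Omega> T\<^sub>h R + L2_inner \<Omega> (\<lambda>x. \<sigma> (T\<^sub>h x)) R = L2_inner \<Omega> R (strain \<Omega> u\<^sub>h)"
    using sols(2) R_M by (auto simp: form_a_def form_b_def form_c_stress m_def \<sigma>_def)
  \<comment> \<open>Both problems carry the same load, so \<open>T\<^sub>h - T\<close> is orthogonal
    to discrete strains; so is \<open>T - P\<close>, because these strains lie in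
    \<open>M\<^sub>h\<close>.\<close>
  have kernel: "L2_inner \<Omega> R (strain \<Omega> w) = 0" if w: "w \<in> X\<^sub>h" for w
  proof -
    have s: "strain \<Omega> w \<in> L2 \<Omega>" using X(1) w by (auto intro!: sub strain_L2_sym H)
    have "L2_inner \<Omega> T\<^sub>h (strain \<Omega> w) = L2_inner \<Omega> T (strain \<Omega> w)"
      using sols w X(1) by (auto simp: form_b_def)
    moreover have "L2_inner \<Omega> T (strain \<Omega> w) - L2_inner \<Omega> P (strain \<Omega> w) = 0"
      using P(2)[OF X(2)[OF w]] L2s s by (simp add: L2_inner_diff_left)
    ultimately show ?thesis
      unfolding R_def[abs_def] using L2s s by (simp add: L2_inner_diff_left)
  qed
  have orth: "L2_inner \<Omega> (\<lambda>x. T x - P x) R = 0" by (rule P(2)[OF R_M])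
  \<comment> \<open>Orthogonality of \<open>T - P\<close> to \<open>R\<close> lets \<open>P\<close>
    replace \<open>T\<close>, and \<open>T\<^sub>h = P + R\<close> contributes the square of
    \<open>x\<close>.\<close>
  have split: "L2_inner \<Omega> T R = L2_inner \<Omega> P R" "L2_inner \<Omega> T\<^sub>h R = x\<^sup>2 + L2_inner \<Omega> P R"
    using orth L2s L2_inner_diff_left[OF L2s(2,3,4)]
    by (simp_all add: L2_inner_diff_left x_def L2_norm_squared R_def[abs_def])
  have E_bound: "L2_inner \<Omega> R (strain \<Omega> v) - L2_inner \<Omega> R (strain \<Omega> u) \<le> x * E"
  proof -
    have "L2_inner \<Omega> R (strain \<Omega> v) - L2_inner \<Omega> R (strain \<Omega> u) =
        L2_inner \<Omega> R (\<lambda>x. strain \<Omega> v x - strain \<Omega> u x)"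
      using L2s by (simp add: L2_inner_diff_right)
    also have "\<dots> = L2_inner \<Omega> R (strain \<Omega> (\<lambda>x. v x - u x))"
      by (rule L2_inner_cong_AE[OF strain_diff[OF \<Omega> H1] D(5,4) L2s(4), symmetric])
    also have "\<dots> \<le> x * E"
      unfolding x_def E_def by (intro L2_Cauchy_Schwarz L2s D)
    finally show ?thesis .
  qed
  have g_bound: "L2_inner \<Omega> g R \<le> L * t\<^sup>2 / 4"
  proof -
    define y where "y = L2_norm \<Omega> g"
    have "y\<^sup>2 = (LINT x|lebesgue_on \<Omega>. (norm (g x))\<^sup>2)"
      by (simp add: y_def L2_norm_squared L2_inner_def power2_norm_eq_inner)
    also have "\<dots> \<le> (LINT x|lebesgue_on \<Omega>. L * (g x \<bullet> (T x - T\<^sub>h x)))"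
    proof (rule integral_mono)
      show "integrable (lebesgue_on \<Omega>) (\<lambda>x. (norm (g x))\<^sup>2)" using D(3) by (simp add: L2_def)
      show "integrable (lebesgue_on \<Omega>) (\<lambda>x. L * (g x \<bullet> (T x - T\<^sub>h x)))"
        by (intro integrable_mult_right L2_inner_integrable D)
      show "(norm (g x))\<^sup>2 \<le> L * (g x \<bullet> (T x - T\<^sub>h x))" for x
        unfolding g_def by (rule coco)
    qed
    also have "\<dots> = L * L2_inner \<Omega> g (\<lambda>x. T x - T\<^sub>h x)"
      by (simp add: L2_inner_def)
    finally have y: "y\<^sup>2 \<le> L * L2_inner \<Omega> g (\<lambda>x. T x - T\<^sub>h x)" .
    have "L2_inner \<Omega> g (\<lambda>x. T x - P x) - L2_inner \<Omega> g (\<lambda>x. T x - T\<^sub>h x) = L2_inner \<Omega> g R"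
      unfolding R_def[abs_def] using L2s D by (simp add: L2_inner_diff_right)
    moreover have "L2_inner \<Omega> g (\<lambda>x. T x - P x) \<le> y * t"
      unfolding y_def t_def by (intro L2_Cauchy_Schwarz D)
    moreover have "y\<^sup>2 / L \<le> L2_inner \<Omega> g (\<lambda>x. T x - T\<^sub>h x)"
      using y L by (simp add: pos_divide_le_eq mult.commute)
    ultimately have "L2_inner \<Omega> g R \<le> y * t - y\<^sup>2 / L"
      by linarith
    \<comment> \<open>Completing the square in \<open>y\<close>; the maximum is attained at
      \<open>y = L * t / 2\<close>.\<close>
    moreover have "y * t - y\<^sup>2 / L = L * t\<^sup>2 / 4 - (y - L * t / 2)\<^sup>2 / L"
      using L by (simp add: field_simps power2_eq_square)
    moreover have "0 \<le> (y - L * t / 2)\<^sup>2 / L" using L by simp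
    ultimately show ?thesis by linarith
  qed
  have gR: "L2_inner \<Omega> g R = L2_inner \<Omega> (\<lambda>x. \<sigma> (T x)) R - L2_inner \<Omega> (\<lambda>x. \<sigma> (T\<^sub>h x)) R"
    unfolding g_def[abs_def] using L2s \<sigma>_L2 by (simp add: L2_inner_diff_left)
  \<comment> \<open>The discrete equation minus the continuous one. The strains of
    \<open>u\<^sub>h\<close> and \<open>v\<close> pair to zero with \<open>R\<close>, so the former
    drops out and the latter may be inserted.\<close>
  have "m * x\<^sup>2 = L2_inner \<Omega> g R + (L2_inner \<Omega> R (strain \<Omega> v) - L2_inner \<Omega> R (strain \<Omega> u))"
    using cont disc kernel[OF v] kernel[OF T(4)] unfolding split gR by (simp add: algebra_simps)
  also have "\<dots> \<le> L * t\<^sup>2 / 4 + x * E"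
    by (intro add_mono g_bound E_bound)
  also have "\<dots> \<le> x * E + 3 / 4 * \<Lambda> * t\<^sup>2"
    using mult_right_mono[OF L(2), of "t\<^sup>2"] by simp
  finally have "m * x\<^sup>2 \<le> x * E + 3 / 4 * \<Lambda> * t\<^sup>2" .
  then have key: "m * (x + t) \<le> E + 2 * (m + \<Lambda>) * t"
    using n \<Lambda> by (intro quadratic_bound) (auto simp: m_def x_def t_def E_def L2_norm_nonneg)
  \<comment> \<open>Pythagoras for the orthogonal parts \<open>R\<close> and \<open>T - P\<close> of
    the error.\<close>
  have "(L2_norm \<Omega> (\<lambda>x. T\<^sub>h x - T x))\<^sup>2 = x\<^sup>2 + t\<^sup>2"
  proof -
    have "(\<lambda>x. T\<^sub>h x - T x) = (\<lambda>x. R x - (T x - P x))" by (auto simp: R_def)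
    then show ?thesis
      using L2s(4) D(1) orth L2_diff[OF L2s(4) D(1)] L2_inner_commute[of \<Omega> R "\<lambda>x. T x - P x"]
      by (simp add: L2_norm_squared x_def t_def L2_inner_diff_left[OF L2s(4) D(1)]
          L2_inner_diff_right[OF L2s(4) D(1)])
  qed
  also have "\<dots> \<le> (x + t)\<^sup>2"
    by (simp add: power2_sum x_def t_def L2_norm_nonneg)
  finally have "L2_norm \<Omega> (\<lambda>x. T\<^sub>h x - T x) \<le> x + t"
    by (rule power2_le_imp_le) (simp add: x_def t_def L2_norm_nonneg)
  then have "m * L2_norm \<Omega> (\<lambda>x. T\<^sub>h x - T x) \<le> m * (x + t)"
    by (intro mult_left_mono) (auto simp: m_def)
  with key show ?thesis by (simp add: m_def E_def t_def)
qed

section \<open>Differences in the discrete tensor spaces, and the final estimate\<close>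

lemma L2_sym_diff:
  assumes "S \<in> L2_sym \<Omega>" "T \<in> L2_sym \<Omega>"
  shows "(\<lambda>x. S x - T x) \<in> L2_sym \<Omega>"
proof -
  have "AE x in lebesgue_on \<Omega>. transpose (S x) = S x" "AE x in lebesgue_on \<Omega>. transpose (T x) = T x"
    using assms by (auto simp: L2_sym_def)
  then have "AE x in lebesgue_on \<Omega>. transpose (S x - T x) = S x - T x"
    by eventually_elim (simp add: transpose_def vec_eq_iff)
  with assms show ?thesis by (auto simp: L2_sym_def intro: L2_diff)
qed

lemma P0_tensors_diff:
  assumes S: "S \<in> P0_tensors \<Omega> \<T>" and T: "T \<in> P0_tensors \<Omega> \<T>"
  shows "(\<lambda>x. S x - T x) \<in> P0_tensors \<Omega> \<T>"
proof -
  have "\<exists>C. AE x in lebesgue_on K. S x - T x = C" if K: "K \<in> \<T>" for K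
  proof -
    obtain A B where "AE x in lebesgue_on K. S x = A" "AE x in lebesgue_on K. T x = B"
      using S T K unfolding P0_tensors_def by blast
    then have "AE x in lebesgue_on K. S x - T x = A - B" by eventually_elim simp
    then show ?thesis by blast
  qed
  with S T show ?thesis by (auto simp: P0_tensors_def intro: L2_sym_diff)
qed

lemma Q_polys_diff:
  assumes "p \<in> Q_polys r" "q \<in> Q_polys r"
  shows "(\<lambda>x. p x - q x) \<in> Q_polys r"
proof -
  obtain a b where "\<And>x. p x = (\<Sum>\<beta>\<in>{\<beta>. \<forall>i. \<beta> i \<le> r}. a \<beta> * (\<Prod>i\<in>UNIV. x $ i ^ \<beta> i))"
    "\<And>x. q x = (\<Sum>\<beta>\<in>{\<beta>. \<forall>i. \<beta> i \<le> r}. b \<beta> * (\<Prod>i\<in>UNIV. x $ i ^ \<beta> i))"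
    using assms unfolding Q_polys_def by blast
  then have "p x - q x = (\<Sum>\<beta>\<in>{\<beta>. \<forall>i. \<beta> i \<le> r}. (a \<beta> - b \<beta>) * (\<Prod>i\<in>UNIV. x $ i ^ \<beta> i))" for x
    by (simp add: sum_subtractf left_diff_distrib)
  then show ?thesis
    unfolding Q_polys_def mem_Collect_eq by (intro exI[of _ "\<lambda>\<beta>. a \<beta> - b \<beta>"] allI)
qed

lemma Q_tensors_diff:
  assumes S: "S \<in> Q_tensors \<Omega> r \<Q>" and T: "T \<in> Q_tensors \<Omega> r \<Q>"
  shows "(\<lambda>x. S x - T x) \<in> Q_tensors \<Omega> r \<Q>"
proof -
  have "\<exists>p\<in>Q_polys r. AE x in lebesgue_on (F ` ref_cube).
      (S x - T x) $ i $ j = p (inv_into ref_cube F x)" if "F \<in> \<Q>" for F i j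
  proof -
    obtain p q where pq: "p \<in> Q_polys r" "q \<in> Q_polys r"
      "AE x in lebesgue_on (F ` ref_cube). S x $ i $ j = p (inv_into ref_cube F x)"
      "AE x in lebesgue_on (F ` ref_cube). T x $ i $ j = q (inv_into ref_cube F x)"
      using S T \<open>F \<in> \<Q>\<close> unfolding Q_tensors_def by blast
    from pq(3,4) have "AE x in lebesgue_on (F ` ref_cube).
        (S x - T x) $ i $ j = p (inv_into ref_cube F x) - q (inv_into ref_cube F x)"
      by eventually_elim simp
    then show ?thesis
      by (intro bexI[OF _ Q_polys_diff[OF pq(1,2)]])
  qed
  with S T show ?thesis by (auto simp: Q_tensors_def intro: L2_sym_diff)
qed

theorem theorem6p2:
  fixes \<Omega> :: "(real^'d) set"
    and n r :: nat
    and h \<Lambda> C\<^sub>1 C\<^sub>2 \<kappa> \<alpha> :: real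
    and lam \<mu> :: "real \<Rightarrow> real"
    and f u u\<^sub>h :: "real^'d \<Rightarrow> real^'d"
    and T T\<^sub>h :: "real^'d \<Rightarrow> real^'d^'d"
    and \<T> :: "real \<Rightarrow> (real^'d) set set"
    and \<Q> :: "real \<Rightarrow> (real^'d \<Rightarrow> real^'d) set"
    and M\<^sub>h :: "(real^'d \<Rightarrow> real^'d^'d) set"
    and X\<^sub>h :: "(real^'d \<Rightarrow> real^'d) set"
    and proj\<^sub>h :: "(real^'d \<Rightarrow> real^'d^'d) \<Rightarrow> real^'d \<Rightarrow> real^'d^'d"
  assumes domain: "admissible_domain \<Omega>"
    and n: "n \<ge> 1"
    and f: "f \<in> L2 \<Omega>"
    and material: "material_functions C\<^sub>1 C\<^sub>2 \<kappa> \<alpha> lam \<mu>"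
    and Lambda: "\<Lambda> > 0"
    and lam_lipschitz: "\<forall>s t. \<bar>lam s * s - lam t * t\<bar> \<le> \<Lambda> * \<bar>t - s\<bar>"
    and mu_lipschitz: "\<forall>s\<ge>0. \<forall>t\<ge>0. \<bar>\<mu> s * s - \<mu> t * t\<bar> \<le> \<Lambda> * \<bar>t - s\<bar>"
    and h: "0 < h" "h \<le> 1"
    and spaces:
      "(simplicial_family \<Omega> \<T> \<and>
          M\<^sub>h = P0_tensors \<Omega> (\<T> h) \<and> X\<^sub>h = P1_vectors \<Omega> (\<T> h)) \<or>
       (cubical_family \<Omega> \<Q> \<and> r \<ge> 1 \<and>
          M\<^sub>h = Q_tensors \<Omega> r (\<Q> h) \<and> X\<^sub>h = Q_vectors \<Omega> r (\<Q> h) \<and>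
          (\<forall>v\<in>X\<^sub>h. strain \<Omega> v \<in> M\<^sub>h))"
    and projector: "L2_projector \<Omega> M\<^sub>h proj\<^sub>h"
    and sol: "regularized_solution n lam \<mu> \<Omega> f (L2_sym \<Omega>) (H10 \<Omega>) T u"
    and sol\<^sub>h: "regularized_solution n lam \<mu> \<Omega> f M\<^sub>h X\<^sub>h T\<^sub>h u\<^sub>h"
  shows "1 / real n * L2_norm \<Omega> (\<lambda>x. T\<^sub>h x - T x)
           \<le> (INF v\<in>X\<^sub>h. L2_norm \<Omega> (strain \<Omega> (\<lambda>x. v x - u x)))
             + 2 * (1 / real n + \<Lambda>) * L2_norm \<Omega> (\<lambda>x. T x - proj\<^sub>h T x)"
proof -
  have \<Omega>: "polytopal_domain \<Omega>" "open \<Omega>" "bounded \<Omega>" and dim: "CARD('d) \<le> 3"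
    using domain by (auto simp: admissible_domain_def polytopal_domain_def)
  have "M\<^sub>h \<subseteq> L2_sym \<Omega> \<and> (\<forall>R\<in>M\<^sub>h. \<forall>S\<in>M\<^sub>h. (\<lambda>x. R x - S x) \<in> M\<^sub>h) \<and>
      X\<^sub>h \<subseteq> H10 \<Omega> \<and> (\<forall>v\<in>X\<^sub>h. strain \<Omega> v \<in> M\<^sub>h)"
    using spaces
  proof
    \<comment> \<open>On simplices the inclusion of strains comes from
      \<open>strain_P1_in_P0\<close>; in the cubical case it is part of
      \<open>spaces\<close>.\<close>
    assume A: "simplicial_family \<Omega> \<T> \<and> M\<^sub>h = P0_tensors \<Omega> (\<T> h) \<and> X\<^sub>h = P1_vectors \<Omega> (\<T> h)"
    then have "simplicial_mesh \<Omega> (\<T> h)" using h by (simp add: simplicial_family_def)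
    then have "\<forall>v\<in>X\<^sub>h. strain \<Omega> v \<in> M\<^sub>h" using A strain_P1_in_P0[OF \<Omega>(1)] by blast
    moreover have "M\<^sub>h \<subseteq> L2_sym \<Omega>" "X\<^sub>h \<subseteq> H10 \<Omega>" using A by (auto simp: P0_tensors_def P1_vectors_def)
    ultimately show ?thesis using A P0_tensors_diff by blast
  next
    assume A: "cubical_family \<Omega> \<Q> \<and> r \<ge> 1 \<and> M\<^sub>h = Q_tensors \<Omega> r (\<Q> h) \<and>
      X\<^sub>h = Q_vectors \<Omega> r (\<Q> h) \<and> (\<forall>v\<in>X\<^sub>h. strain \<Omega> v \<in> M\<^sub>h)"
    then have "M\<^sub>h \<subseteq> L2_sym \<Omega>" "X\<^sub>h \<subseteq> H10 \<Omega>" by (auto simp: Q_tensors_def Q_vectors_def)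
    then show ?thesis using A Q_tensors_diff by blast
  qed
  then have MX: "M\<^sub>h \<subseteq> L2_sym \<Omega>" "\<And>R S. R \<in> M\<^sub>h \<Longrightarrow> S \<in> M\<^sub>h \<Longrightarrow> (\<lambda>x. R x - S x) \<in> M\<^sub>h"
    "X\<^sub>h \<subseteq> H10 \<Omega>" "\<And>v. v \<in> X\<^sub>h \<Longrightarrow> strain \<Omega> v \<in> M\<^sub>h"
    by blast+
  have "T \<in> L2_sym \<Omega>" "u\<^sub>h \<in> X\<^sub>h" using sol sol\<^sub>h by (auto simp: regularized_solution_def)
  then have P: "proj\<^sub>h T \<in> M\<^sub>h" "\<And>S. S \<in> M\<^sub>h \<Longrightarrow> L2_inner \<Omega> (\<lambda>x. T x - proj\<^sub>h T x) S = 0"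
    using projector by (auto simp: L2_projector_def)
  \<comment> \<open>The projection error is independent of \<open>v\<close> and is moved to the
    left, so that the infimum stands alone; \<open>u\<^sub>h\<close> shows that it is taken over a
    nonempty set.\<close>
  have "1 / real n * L2_norm \<Omega> (\<lambda>x. T\<^sub>h x - T x)
      - 2 * (1 / real n + \<Lambda>) * L2_norm \<Omega> (\<lambda>x. T x - proj\<^sub>h T x)
    \<le> (INF v\<in>X\<^sub>h. L2_norm \<Omega> (strain \<Omega> (\<lambda>x. v x - u x)))"
  proof (rule cINF_greatest)
    show "X\<^sub>h \<noteq> {}" using \<open>u\<^sub>h \<in> X\<^sub>h\<close> by blast
    fix v assume "v \<in> X\<^sub>h"
    have "1 / real n * L2_norm \<Omega> (\<lambda>x. T\<^sub>h x - T x) \<le> L2_norm \<Omega> (strain \<Omega> (\<lambda>x. v x - u x))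
        + 2 * (1 / real n + \<Lambda>) * L2_norm \<Omega> (\<lambda>x. T x - proj\<^sub>h T x)"
      by (rule mixed_error_estimate)
        (use \<Omega> dim n Lambda material lam_lipschitz mu_lipschitz MX P sol sol\<^sub>h \<open>v \<in> X\<^sub>h\<close> in blast)+
    then show "1 / real n * L2_norm \<Omega> (\<lambda>x. T\<^sub>h x - T x)
        - 2 * (1 / real n + \<Lambda>) * L2_norm \<Omega> (\<lambda>x. T x - proj\<^sub>h T x)
      \<le> L2_norm \<Omega> (strain \<Omega> (\<lambda>x. v x - u x))"
      by linarith
  qed
  then show ?thesis by linarith
qed

end
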